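(* Let $r,k,s$ be positive integers, let $A=\mathbb{D}^r_k$ be the algebra of $r$-jets at $0$ of smooth functions $\mathbb{R}^k\to\mathbb{R}$, and let $(\mathbb{D}^r_k)_s=A_s$ be the real vector space of skew-symmetric $s$-linear maps $F:A\times\dots\times A\to A^*$ satisfying the derivation-type identity given in the context. Let $Z$ be the set of all $(i_1,\dots,i_s,\alpha)\in\{1,\dots,k\}^s\times\mathbb{N}^k$ such that $i_1<\dots<i_s$ and either $|\alpha|<r$, or $|\alpha|=r$ and $i_s<\max\{l\in\{1,\dots,k\}:\alpha^l>0\}$. Then the map $I:(\mathbb{D}^r_k)_s\to\mathbb{R}^Z$ given by $$I(F)(i_1,\dots,i_s,\alpha)=F(x^{i_1},\dots,x^{i_s})(x^\alpha)$$ for every $F\in(\mathbb{D}^r_k)_s$ and every $(i_1,\dots,i_s,\alpha)\in Z$ is an isomorphism of vector spaces.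
   Context: $\mathbb{N}$ denotes the set of non-negative integers. For $\alpha=(\alpha^1,\dots,\alpha^k)\in\mathbb{N}^k$ put $|\alpha|=\alpha^1+\dots+\alpha^k$. $\mathbb{D}^r_k$ is the commutative unital $\mathbb{R}$-algebra of $r$-jets at $0$ of smooth functions $\mathbb{R}^k\to\mathbb{R}$. For $i\in\{1,\dots,k\}$, $x^i\in\mathbb{D}^r_k$ (with $i$ an upper index, not a power) is the $r$-jet at $0$ of the coordinate function $u\mapsto u^i$, and for $\alpha\in\mathbb{N}^k$, $x^\alpha=(x^1)^{\alpha^1}\cdots(x^k)^{\alpha^k}$. The elements $x^\varepsilon$ with $\varepsilon\in\mathbb{N}^k$, $|\varepsilon|\le r$, form a basis of $\mathbb{D}^r_k$ over $\mathbb{R}$, and $x^\zeta x^\eta=x^{\zeta+\eta}$ if $|\zeta+\eta|\le r$ and $x^\zeta x^\eta=0$ otherwise. (Equivalently, $\mathbb{D}^r_k\cong\mathbb{R}[x^1,\dots,x^k]/(x^1,\dots,x^k)^{r+1}$.) For a finite-dimensional commutative unital $\mathbb{R}$-algebra $A$, $A^*$ denotes the vector space of $\mathbb{R}$-linear functions $A\to\mathbb{R}$. For a positive integer $s$, $A_s$ is the real vector space of skew-symmetric $s$-linear (over $\mathbb{R}$) maps $F:A\times\dots\times A\to A^*$ satisfying $$F(a_1,\dots,a_{t-1},bc,a_{t+1},\dots,a_s)(d)=F(a_1,\dots,a_{t-1},b,a_{t+1},\dots,a_s)(cd)+F(a_1,\dots,a_{t-1},c,a_{t+1},\dots,a_s)(bd)$$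 for every $t\in\{1,\dots,s\}$ and all $a_1,\dots,a_{t-1},a_{t+1},\dots,a_s,b,c,d\in A$. $\mathbb{R}^Z$ is the vector space of all functions $Z\to\mathbb{R}$. *)

theory Defs
  imports "HOL-Analysis.Analysis" "HOL-Algebra.Algebraic_Closure_Type"
begin

abbreviation real_field :: "real ring"
  where "real_field \<equiv> ring_of_type_algebra"


section \<open>Smooth functions and their jets at the origin\<close>

definition partial_deriv :: "'k::finite \<Rightarrow> (real^'k \<Rightarrow> real) \<Rightarrow> real^'k \<Rightarrow> real"
  where "partial_deriv i f u = frechet_derivative f (at u) (axis i 1)"

fun iter_partial :: "'k::finite list \<Rightarrow> (real^'k \<Rightarrow> real) \<Rightarrow> real^'k \<Rightarrow> real"
  where
    "iter_partial [] f = f"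
  | "iter_partial (i # is) f = iter_partial is (partial_deriv i f)"

text \<open>
  All iterated partial derivatives are Frechet differentiable everywhere. They are then
  all continuous, so this is the usual class of infinitely differentiable functions.
  On smooth functions the value of \<^const>\<open>partial_deriv\<close> is therefore never the arbitrary
  one that \<^const>\<open>frechet_derivative\<close> takes at points of non-differentiability.
\<close>
definition smooth :: "(real^'k::finite \<Rightarrow> real) \<Rightarrow> bool"
  where "smooth f \<longleftrightarrow> (\<forall>is u. iter_partial is f differentiable (at u))"

definition smooth_ring :: "(real^'k::finite \<Rightarrow> real) ring"
  where "smooth_ring = \<lparr>carrier = {f. smooth f}, mult = (\<lambda>f g u. f u * g u), one = (\<lambda>u. 1),
           zero = (\<lambda>u. 0), add = (\<lambda>f g u. f u + g u)\<rparr>"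

text \<open>
  Two smooth functions have the same jet of order \<open>r\<close> at \<open>0\<close> iff all their partial derivatives
  of order at most \<open>r\<close> agree at \<open>0\<close>, i.e. iff their difference lies in the following ideal.
\<close>
definition flat_ideal :: "nat \<Rightarrow> (real^'k::finite \<Rightarrow> real) set"
  where "flat_ideal r = {f. smooth f \<and> (\<forall>is. length is \<le> r \<longrightarrow> iter_partial is f 0 = 0)}"

definition jet :: "nat \<Rightarrow> (real^'k::finite \<Rightarrow> real) \<Rightarrow> (real^'k \<Rightarrow> real) set"
  where "jet r f = flat_ideal r +>\<^bsub>smooth_ring\<^esub> f"

text \<open>
  The algebra of jets of order \<open>r\<close>. The finite type \<open>'k\<close> indexes the coordinates. A real number
  acts as multiplication by the jet of the constant function.
\<close>
definition jet_algebra :: "nat \<Rightarrow> (real, (real^'k::finite \<Rightarrow> real) set) module"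
  where "jet_algebra r =
    (let Q = smooth_ring Quot flat_ideal r in
      \<lparr>carrier = carrier Q, mult = mult Q, one = one Q, zero = zero Q, add = add Q,
       smult = (\<lambda>c a. jet r (\<lambda>u. c) \<otimes>\<^bsub>Q\<^esub> a)\<rparr>)"

definition jet_coord :: "nat \<Rightarrow> 'k::finite \<Rightarrow> (real^'k \<Rightarrow> real) set"
  where "jet_coord r i = jet r (\<lambda>u. u $ i)"

definition jet_monom :: "nat \<Rightarrow> ('k::finite \<Rightarrow> nat) \<Rightarrow> (real^'k \<Rightarrow> real) set"
  where "jet_monom r \<alpha> =
    (\<Otimes>\<^bsub>jet_algebra r\<^esub>i\<in>UNIV. jet_coord r i [^]\<^bsub>jet_algebra r\<^esub> \<alpha> i)"


section \<open>The vector space of forms attached to an algebra\<close>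

text \<open>
  A function that is only meaningful on a subset is represented by its extension by \<open>0\<close>, so
  that the vector space operations on such functions are the pointwise ones.
\<close>
definition dual :: "(real, 'a) module \<Rightarrow> ('a \<Rightarrow> real) set"
  where "dual A = {\<phi>.
    (\<forall>a. a \<notin> carrier A \<longrightarrow> \<phi> a = 0) \<and>
    (\<forall>a\<in>carrier A. \<forall>b\<in>carrier A. \<phi> (a \<oplus>\<^bsub>A\<^esub> b) = \<phi> a + \<phi> b) \<and>
    (\<forall>c. \<forall>a\<in>carrier A. \<phi> (c \<odot>\<^bsub>A\<^esub> a) = c * \<phi> a)}"

definition tuples :: "(real, 'a) module \<Rightarrow> nat \<Rightarrow> 'a list set"
  where "tuples A s = {v. length v = s \<and> set v \<subseteq> carrier A}"

definition multilinear_maps :: "(real, 'a) module \<Rightarrow> nat \<Rightarrow> ('a list \<Rightarrow> 'a \<Rightarrow> real) set"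
  where "multilinear_maps A s = {F.
    (\<forall>v\<in>tuples A s. F v \<in> dual A) \<and>
    (\<forall>v. v \<notin> tuples A s \<longrightarrow> F v = (\<lambda>d. 0)) \<and>
    (\<forall>v\<in>tuples A s. \<forall>t<s. \<forall>a\<in>carrier A. \<forall>b\<in>carrier A. \<forall>d\<in>carrier A.
      F (v[t := a \<oplus>\<^bsub>A\<^esub> b]) d = F (v[t := a]) d + F (v[t := b]) d) \<and>
    (\<forall>v\<in>tuples A s. \<forall>t<s. \<forall>c. \<forall>a\<in>carrier A. \<forall>d\<in>carrier A.
      F (v[t := c \<odot>\<^bsub>A\<^esub> a]) d = c * F (v[t := a]) d)}"

definition skew_symmetric :: "(real, 'a) module \<Rightarrow> nat \<Rightarrow> ('a list \<Rightarrow> 'a \<Rightarrow> real) \<Rightarrow> bool"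
  where "skew_symmetric A s F \<longleftrightarrow>
    (\<forall>v\<in>tuples A s. \<forall>p<s. \<forall>q<s. p \<noteq> q \<longrightarrow>
      (\<forall>d\<in>carrier A. F (v[p := v ! q, q := v ! p]) d = - F v d))"

definition derivation_like :: "(real, 'a) module \<Rightarrow> nat \<Rightarrow> ('a list \<Rightarrow> 'a \<Rightarrow> real) \<Rightarrow> bool"
  where "derivation_like A s F \<longleftrightarrow>
    (\<forall>v\<in>tuples A s. \<forall>t<s. \<forall>b\<in>carrier A. \<forall>c\<in>carrier A. \<forall>d\<in>carrier A.
      F (v[t := b \<otimes>\<^bsub>A\<^esub> c]) d = F (v[t := b]) (c \<otimes>\<^bsub>A\<^esub> d) + F (v[t := c]) (b \<otimes>\<^bsub>A\<^esub> d))"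

text \<open>
  Vector spaces are modules over \<^term>\<open>real_field\<close>; the fields \<open>mult\<close> and \<open>one\<close> of the record
  play no role for them.
\<close>
definition forms :: "(real, 'a) module \<Rightarrow> nat \<Rightarrow> (real, 'a list \<Rightarrow> 'a \<Rightarrow> real) module"
  where "forms A s =
    \<lparr>carrier = {F \<in> multilinear_maps A s. skew_symmetric A s F \<and> derivation_like A s F},
     mult = undefined, one = undefined,
     zero = (\<lambda>v d. 0), add = (\<lambda>F G v d. F v d + G v d), smult = (\<lambda>c F v d. c * F v d)\<rparr>"

definition function_space :: "'z set \<Rightarrow> (real, 'z \<Rightarrow> real) module"
  where "function_space Z =
    \<lparr>carrier = {\<phi>. \<forall>z. z \<notin> Z \<longrightarrow> \<phi> z = 0}, mult = undefined, one = undefined,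
     zero = (\<lambda>z. 0), add = (\<lambda>\<phi> \<psi> z. \<phi> z + \<psi> z), smult = (\<lambda>c \<phi> z. c * \<phi> z)\<rparr>"

definition vector_space_iso ::
    "(real, 'a) module \<Rightarrow> (real, 'b) module \<Rightarrow> ('a \<Rightarrow> 'b) set"
  where "vector_space_iso V W = {h \<in> iso (add_monoid V) (add_monoid W).
    \<forall>c. \<forall>x\<in>carrier V. h (c \<odot>\<^bsub>V\<^esub> x) = c \<odot>\<^bsub>W\<^esub> h x}"


section \<open>The index set and the coordinate map\<close>

text \<open>
  With a linear order on the finite type \<open>'k\<close>, the set \<open>{1..k}\<close> is rendered by \<open>'k\<close>.
  For \<open>s \<ge> 1\<close> the last entry of the list is \<open>i\<^sub>s\<close>, and for \<open>r \<ge> 1\<close> the maximum is only taken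
  over nonempty sets.
\<close>
definition index_set :: "nat \<Rightarrow> nat \<Rightarrow> ('k::{finite,linorder} list \<times> ('k \<Rightarrow> nat)) set"
  where "index_set r s = {(is, \<alpha>). length is = s \<and> sorted_wrt (<) is \<and>
    (sum \<alpha> UNIV < r \<or> sum \<alpha> UNIV = r \<and> last is < Max {l. \<alpha> l > 0})}"

definition coord_map :: "nat \<Rightarrow> nat \<Rightarrow>
    ((real^'k::{finite,linorder} \<Rightarrow> real) set list \<Rightarrow>
      (real^'k::{finite,linorder} \<Rightarrow> real) set \<Rightarrow> real) \<Rightarrow>
    'k list \<times> ('k \<Rightarrow> nat) \<Rightarrow> real"
  where "coord_map r s F = (\<lambda>(is, \<alpha>).
    if (is, \<alpha>) \<in> index_set r s then F (map (jet_coord r) is) (jet_monom r \<alpha>) else 0)"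


section \<open>The structures are an algebra and vector spaces\<close>

lemma real_field_simps [simp]:
  "carrier real_field = UNIV" "x \<otimes>\<^bsub>real_field\<^esub> y = x * y" "x \<oplus>\<^bsub>real_field\<^esub> y = x + y"
  "\<one>\<^bsub>real_field\<^esub> = 1" "\<zero>\<^bsub>real_field\<^esub> = 0"
  by (simp_all add: ring_of_type_algebra_def)

lemma module_function_space: "Module.module real_field (function_space Z)"
proof (rule Module.moduleI)
  show "abelian_group (function_space Z)"
  proof (rule abelian_groupI)
    fix x assume "x \<in> carrier (function_space Z)"
    then show "\<exists>y\<in>carrier (function_space Z).
        y \<oplus>\<^bsub>function_space Z\<^esub> x = \<zero>\<^bsub>function_space Z\<^esub>"
      by (intro bexI[of _ "\<lambda>z. - x z"]) (auto simp: function_space_def)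
  qed (auto simp: function_space_def algebra_simps)
qed (auto simp: function_space_def algebra_simps cring_from_type_algebra)

lemma module_forms: "Module.module real_field (forms A s)"
proof (rule Module.moduleI)
  have smult: "(\<lambda>v d. c * F v d) \<in> carrier (forms A s)" if "F \<in> carrier (forms A s)" for c F
    using that
    unfolding forms_def multilinear_maps_def skew_symmetric_def derivation_like_def dual_def
    by (auto simp: algebra_simps fun_eq_iff)
  show "abelian_group (forms A s)"
  proof (rule abelian_groupI)
    fix F assume "F \<in> carrier (forms A s)"
    from smult[OF this, of "-1"]
    show "\<exists>G\<in>carrier (forms A s). G \<oplus>\<^bsub>forms A s\<^esub> F = \<zero>\<^bsub>forms A s\<^esub>"
      by (intro bexI[of _ "\<lambda>v d. - 1 * F v d"]) (auto simp: forms_def)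
  next
    fix F G assume "F \<in> carrier (forms A s)" "G \<in> carrier (forms A s)"
    then show "F \<oplus>\<^bsub>forms A s\<^esub> G \<in> carrier (forms A s)"
      unfolding forms_def multilinear_maps_def skew_symmetric_def derivation_like_def dual_def
      by (auto simp: algebra_simps fun_eq_iff)
  qed (auto simp: forms_def multilinear_maps_def skew_symmetric_def derivation_like_def dual_def
      algebra_simps)
  fix c F assume "F \<in> carrier (forms A s)"
  from smult[OF this, of c]
  show "c \<odot>\<^bsub>forms A s\<^esub> F \<in> carrier (forms A s)"
    by (simp add: forms_def)
next
  show "cring real_field" by (rule cring_from_type_algebra)
next
  fix a b F assume "F \<in> carrier (forms A s)"
  show "(a \<oplus>\<^bsub>real_field\<^esub> b) \<odot>\<^bsub>forms A s\<^esub> F =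
      a \<odot>\<^bsub>forms A s\<^esub> F \<oplus>\<^bsub>forms A s\<^esub> b \<odot>\<^bsub>forms A s\<^esub> F"
    by (simp add: forms_def distrib_right)
next
  fix a F G assume "F \<in> carrier (forms A s)"
  show "a \<odot>\<^bsub>forms A s\<^esub> (F \<oplus>\<^bsub>forms A s\<^esub> G) =
      a \<odot>\<^bsub>forms A s\<^esub> F \<oplus>\<^bsub>forms A s\<^esub> a \<odot>\<^bsub>forms A s\<^esub> G"
    by (simp add: forms_def distrib_left)
next
  fix a b F assume "F \<in> carrier (forms A s)"
  show "(a \<otimes>\<^bsub>real_field\<^esub> b) \<odot>\<^bsub>forms A s\<^esub> F = a \<odot>\<^bsub>forms A s\<^esub> (b \<odot>\<^bsub>forms A s\<^esub> F)"
    by (simp add: forms_def mult.assoc)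
next
  fix F assume "F \<in> carrier (forms A s)"
  show "\<one>\<^bsub>real_field\<^esub> \<odot>\<^bsub>forms A s\<^esub> F = F"
    by (simp add: forms_def)
qed

lemma smooth_iff:
  "smooth f \<longleftrightarrow> (\<forall>u. f differentiable (at u)) \<and> (\<forall>i. smooth (partial_deriv i f))"
proof
  assume f: "smooth f"
  have "f differentiable (at u)" for u
    using f[unfolded smooth_def, rule_format, of "[]"] by simp
  moreover have "iter_partial is (partial_deriv i f) differentiable (at u)" for i "is" u
    using f[unfolded smooth_def, rule_format, of "i # is"] by simp
  ultimately show "(\<forall>u. f differentiable (at u)) \<and> (\<forall>i. smooth (partial_deriv i f))"
    by (simp add: smooth_def)
next
  assume f: "(\<forall>u. f differentiable (at u)) \<and> (\<forall>i. smooth (partial_deriv i f))"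
  show "smooth f"
    unfolding smooth_def
  proof (intro allI)
    fix "is" u show "iter_partial is f differentiable (at u)"
      using f by (cases "is") (auto simp: smooth_def)
  qed
qed

lemma smoothD: "smooth f \<Longrightarrow> f differentiable (at u)" "smooth f \<Longrightarrow> smooth (partial_deriv i f)"
  using smooth_iff by blast+

lemma partial_deriv_eqI: "(f has_derivative f') (at u) \<Longrightarrow> partial_deriv i f u = f' (axis i 1)"
  unfolding partial_deriv_def by (simp flip: frechet_derivative_at)

lemma partial_deriv_const: "partial_deriv i (\<lambda>u. c) = (\<lambda>u. 0)"
  by (rule ext, subst partial_deriv_eqI) (auto intro: derivative_eq_intros)

lemma partial_deriv_coord: "partial_deriv i (\<lambda>u. u $ j) = (\<lambda>u. if i = j then 1 else 0)"
proof (rule ext)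
  fix u :: "real^'a"
  have "((\<lambda>u. u $ j) has_derivative (\<lambda>u. u $ j)) (at u)"
    by (rule bounded_linear_imp_has_derivative[OF bounded_linear_vec_nth])
  from partial_deriv_eqI[OF this] show "partial_deriv i (\<lambda>u. u $ j) u = (if i = j then 1 else 0)"
    by (auto simp: axis_def)
qed

lemma partial_deriv_add:
  assumes "\<And>u. f differentiable (at u)" "\<And>u. g differentiable (at u)"
  shows "partial_deriv i (\<lambda>u. f u + g u) = (\<lambda>u. partial_deriv i f u + partial_deriv i g u)"
proof (rule ext)
  fix u
  from assms have "(f has_derivative frechet_derivative f (at u)) (at u)"
    "(g has_derivative frechet_derivative g (at u)) (at u)"
    by (simp_all flip: frechet_derivative_works)
  from partial_deriv_eqI[OF has_derivative_add[OF this]]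
  show "partial_deriv i (\<lambda>u. f u + g u) u = partial_deriv i f u + partial_deriv i g u"
    by (simp add: partial_deriv_def)
qed

lemma partial_deriv_mult:
  assumes "\<And>u. f differentiable (at u)" "\<And>u. g differentiable (at u)"
  shows "partial_deriv i (\<lambda>u. f u * g u) =
    (\<lambda>u. f u * partial_deriv i g u + partial_deriv i f u * g u)"
proof (rule ext)
  fix u
  from assms have "(f has_derivative frechet_derivative f (at u)) (at u)"
    "(g has_derivative frechet_derivative g (at u)) (at u)"
    by (simp_all flip: frechet_derivative_works)
  from partial_deriv_eqI[OF has_derivative_mult[OF this]]
  show "partial_deriv i (\<lambda>u. f u * g u) u = f u * partial_deriv i g u + partial_deriv i f u * g u"
    by (simp add: partial_deriv_def)
qed

lemma iter_partial_zero: "iter_partial is (\<lambda>u. 0) = (\<lambda>u. 0)"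
  by (induction "is") (simp_all add: partial_deriv_const)

lemma smooth_const: "smooth (\<lambda>u. c)"
proof -
  have "smooth (\<lambda>u::real^'a. 0)"
    by (simp add: smooth_def iter_partial_zero)
  then show ?thesis
    by (subst smooth_iff) (simp add: partial_deriv_const)
qed

lemma smooth_coord: "smooth (\<lambda>u. u $ j)"
proof (subst smooth_iff, intro conjI allI)
  show "(\<lambda>u::real^'a. u $ j) differentiable (at u)" for u
    by (rule bounded_linear_imp_differentiable[OF bounded_linear_vec_nth])
qed (simp only: partial_deriv_coord smooth_const)

lemma iter_partial_add:
  "smooth f \<Longrightarrow> smooth g \<Longrightarrow>
    iter_partial is (\<lambda>u. f u + g u) = (\<lambda>u. iter_partial is f u + iter_partial is g u)"
  by (induction "is" arbitrary: f g) (simp_all add: partial_deriv_add smoothD)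

lemma smooth_add: "smooth f \<Longrightarrow> smooth g \<Longrightarrow> smooth (\<lambda>u. f u + g u)"
  by (subst smooth_def) (auto simp: iter_partial_add smooth_def intro!: differentiable_add)

lemma smooth_mult:
  assumes "smooth f" "smooth g"
  shows "smooth (\<lambda>u. f u * g u)"
proof -
  define D :: "nat \<Rightarrow> (real^'a \<Rightarrow> real) \<Rightarrow> bool"
    where "D n f \<longleftrightarrow> (\<forall>is u. length is \<le> n \<longrightarrow> iter_partial is f differentiable (at u))" for n f
  have D_diff: "f differentiable (at u)" if "D n f" for n f u
    using that[unfolded D_def, rule_format, of "[]" u] by simp
  have D_partial: "D n (partial_deriv i f)" if "D (Suc n) f" for n f i
    unfolding D_def
  proof (intro allI impI)
    fix "is" :: "'a list" and u assume "length is \<le> n"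
    then show "iter_partial is (partial_deriv i f) differentiable (at u)"
      using that[unfolded D_def, rule_format, of "i # is" u] by simp
  qed
  have D_mono: "D n f" if "D (Suc n) f" for n f
    using that by (auto simp: D_def)
  have D_0: "D 0 f" if "\<And>u. f differentiable (at u)" for f
    using that by (auto simp: D_def)
  have D_Suc: "D (Suc n) f"
    if "\<And>u. f differentiable (at u)" "\<And>i. D n (partial_deriv i f)" for n f
    unfolding D_def
  proof (intro allI impI)
    fix "is" :: "'a list" and u assume "length is \<le> Suc n"
    then show "iter_partial is f differentiable (at u)"
      using that by (cases "is") (auto simp: D_def)
  qed
  have D_add: "D n (\<lambda>u. f u + g u)" if "D n f" "D n g" for n f g
    using that
  proof (induction n arbitrary: f g)
    case 0
    then show ?case by (intro D_0) (rule differentiable_add[OF D_diff D_diff])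
  next
    case (Suc n)
    note diff = D_diff[OF Suc.prems(1)] D_diff[OF Suc.prems(2)]
    show ?case
    proof (rule D_Suc)
      show "D n (partial_deriv i (\<lambda>u. f u + g u))" for i
        unfolding partial_deriv_add[OF diff] using Suc by (blast intro: D_partial)
    qed (auto intro!: differentiable_add diff)
  qed
  have D_mult: "D n (\<lambda>u. f u * g u)" if "D n f" "D n g" for n f g
    using that
  proof (induction n arbitrary: f g)
    case 0
    then show ?case by (intro D_0) (rule differentiable_mult[OF D_diff D_diff])
  next
    case (Suc n)
    note diff = D_diff[OF Suc.prems(1)] D_diff[OF Suc.prems(2)]
    show ?case
    proof (rule D_Suc)
      show "D n (partial_deriv i (\<lambda>u. f u * g u))" for i
        unfolding partial_deriv_mult[OF diff]
        using Suc.prems by (intro D_add Suc.IH D_partial) (simp_all add: D_mono)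
    qed (auto intro!: differentiable_mult diff)
  qed
  have "D n f" "D n g" for n
    using assms by (auto simp: D_def smooth_def)
  then have "D n (\<lambda>u. f u * g u)" for n
    by (rule D_mult)
  then show ?thesis
    by (auto simp: D_def smooth_def)
qed

lemma flat_mult:
  assumes "f \<in> flat_ideal r" "smooth g"
  shows "(\<lambda>u. f u * g u) \<in> flat_ideal r"
proof -
  have "iter_partial is (\<lambda>u. f u * g u) 0 = 0"
    if "smooth f" "smooth g" "\<forall>is. length is \<le> n \<longrightarrow> iter_partial is f 0 = 0" "length is \<le> n"
    for n "is" and f g :: "real^'a \<Rightarrow> real"
    using that
  proof (induction "is" arbitrary: n f g)
    case Nil
    from Nil(3)[rule_format, of "[]"] show ?case by simp
  next
    case (Cons i "is")
    then obtain m where m: "n = Suc m" "length is \<le> m" by (cases n) auto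
    have "\<forall>is. length is \<le> m \<longrightarrow> iter_partial is (partial_deriv i f) 0 = 0"
    proof (intro allI impI)
      fix js :: "'a list" assume "length js \<le> m"
      then show "iter_partial js (partial_deriv i f) 0 = 0"
        using Cons.prems(3)[rule_format, of "i # js"] m by simp
    qed
    then have 1: "iter_partial is (\<lambda>u. partial_deriv i f u * g u) 0 = 0"
      using Cons.prems m by (intro Cons.IH[of _ _ m]) (auto intro: smoothD)
    have 2: "iter_partial is (\<lambda>u. f u * partial_deriv i g u) 0 = 0"
      using Cons.prems m by (intro Cons.IH[of _ _ m]) (auto intro: smoothD)
    from 1 2 Cons.prems show ?case
      by (simp add: partial_deriv_mult iter_partial_add smooth_mult smoothD)
  qed
  then show ?thesis
    using assms by (auto simp: flat_ideal_def smooth_mult)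
qed

lemma flat_add: "f \<in> flat_ideal r \<Longrightarrow> g \<in> flat_ideal r \<Longrightarrow> (\<lambda>u. f u + g u) \<in> flat_ideal r"
  by (auto simp: flat_ideal_def smooth_add iter_partial_add)

lemma cring_smooth_ring: "cring (smooth_ring :: (real^'a \<Rightarrow> real) ring)"
proof (rule cringI)
  show "abelian_group (smooth_ring :: (real^'a \<Rightarrow> real) ring)"
  proof (rule abelian_groupI)
    fix f :: "real^'a \<Rightarrow> real" assume "f \<in> carrier smooth_ring"
    then have "smooth (\<lambda>u. - 1 * f u)"
      by (intro smooth_mult smooth_const) (auto simp: smooth_ring_def)
    then show "\<exists>g\<in>carrier smooth_ring. g \<oplus>\<^bsub>smooth_ring\<^esub> f = \<zero>\<^bsub>smooth_ring\<^esub>"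
      by (intro bexI[of _ "\<lambda>u. - 1 * f u"]) (auto simp: smooth_ring_def)
  qed (auto simp: smooth_ring_def smooth_const smooth_add algebra_simps)
  show "comm_monoid (smooth_ring :: (real^'a \<Rightarrow> real) ring)"
    by (rule comm_monoidI) (auto simp: smooth_ring_def smooth_const smooth_mult algebra_simps)
qed (auto simp: smooth_ring_def algebra_simps)

lemma ideal_flat_ideal: "ideal (flat_ideal r) smooth_ring"
proof -
  interpret S: cring "smooth_ring :: (real^'a \<Rightarrow> real) ring"
    by (rule cring_smooth_ring)
  show "ideal (flat_ideal r :: (real^'a \<Rightarrow> real) set) smooth_ring"
  proof (rule idealI)
    show "subgroup (flat_ideal r) (add_monoid (smooth_ring :: (real^'a \<Rightarrow> real) ring))"
    proof (rule S.add.subgroupI)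
      show "flat_ideal r \<subseteq> carrier (smooth_ring :: (real^'a \<Rightarrow> real) ring)"
        by (auto simp: flat_ideal_def smooth_ring_def)
      have "(\<lambda>u::real^'a. 0) \<in> flat_ideal r"
        by (simp add: flat_ideal_def smooth_const iter_partial_zero)
      then show "flat_ideal r \<noteq> ({} :: (real^'a \<Rightarrow> real) set)" by blast
    next
      fix f :: "real^'a \<Rightarrow> real" assume f: "f \<in> flat_ideal r"
      then have neg: "(\<lambda>u. f u * - 1) \<in> flat_ideal r"
        by (intro flat_mult smooth_const)
      have "\<ominus>\<^bsub>smooth_ring\<^esub> f = (\<lambda>u. f u * - 1)"
        using f neg by (intro S.minus_equality) (auto simp: smooth_ring_def flat_ideal_def)
      with neg show "\<ominus>\<^bsub>smooth_ring\<^esub> f \<in> flat_ideal r" by simp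
    next
      fix f g :: "real^'a \<Rightarrow> real" assume "f \<in> flat_ideal r" "g \<in> flat_ideal r"
      then show "f \<oplus>\<^bsub>smooth_ring\<^esub> g \<in> flat_ideal r"
        by (simp add: smooth_ring_def flat_add)
    qed
  next
    fix f g :: "real^'a \<Rightarrow> real" assume "f \<in> flat_ideal r" "g \<in> carrier smooth_ring"
    then show "f \<otimes>\<^bsub>smooth_ring\<^esub> g \<in> flat_ideal r" "g \<otimes>\<^bsub>smooth_ring\<^esub> f \<in> flat_ideal r"
      using flat_mult[of f r g] by (simp_all add: smooth_ring_def mult.commute)
  qed (rule S.ring_axioms)
qed

lemma jet_eq_iff:
  assumes "smooth f" "smooth g"
  shows "jet r f = jet r g \<longleftrightarrow> (\<forall>is. length is \<le> r \<longrightarrow> iter_partial is f 0 = iter_partial is g 0)"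
proof -
  interpret S: cring "smooth_ring :: (real^'a \<Rightarrow> real) ring"
    by (rule cring_smooth_ring)
  interpret I: ideal "flat_ideal r" "smooth_ring :: (real^'a \<Rightarrow> real) ring"
    by (rule ideal_flat_ideal)
  have carr: "f \<in> carrier smooth_ring" "g \<in> carrier smooth_ring"
    using assms by (auto simp: smooth_ring_def)
  have neg: "smooth (\<lambda>u. - 1 * g u)"
    by (intro smooth_mult smooth_const assms)
  have "\<ominus>\<^bsub>smooth_ring\<^esub> g = (\<lambda>u. - 1 * g u)"
    using neg carr by (intro S.minus_equality) (auto simp: smooth_ring_def)
  then have minus: "f \<ominus>\<^bsub>smooth_ring\<^esub> g = (\<lambda>u. f u + - 1 * g u)"
    by (simp add: a_minus_def smooth_ring_def)
  have it: "iter_partial is f = (\<lambda>u. iter_partial is (\<lambda>u. f u + - 1 * g u) u + iter_partial is g u)"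
    for "is"
    using iter_partial_add[OF smooth_add[OF assms(1) neg] assms(2), of "is"] by simp
  have "jet r f = jet r g \<longleftrightarrow> f \<ominus>\<^bsub>smooth_ring\<^esub> g \<in> flat_ideal r"
    unfolding jet_def using S.quotient_eq_iff_same_a_r_cos[OF ideal_flat_ideal carr] by simp
  also have "\<dots> \<longleftrightarrow> (\<forall>is. length is \<le> r \<longrightarrow> iter_partial is f 0 = iter_partial is g 0)"
    unfolding minus flat_ideal_def using smooth_add[OF assms(1) neg] it
    by (simp add: fun_eq_iff)
  finally show ?thesis .
qed

lemma algebra_jet_algebra: "Module.algebra real_field (jet_algebra r)"
proof -
  let ?S = "smooth_ring :: (real^'a \<Rightarrow> real) ring"
  define Q where "Q = ?S Quot flat_ideal r"
  interpret I: ideal "flat_ideal r" ?S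
    by (rule ideal_flat_ideal)
  interpret Q: cring Q
    unfolding Q_def by (rule I.quotient_is_cring[OF cring_smooth_ring])
  have const: "(\<lambda>u. c) \<in> carrier ?S" for c :: real
    by (simp add: smooth_ring_def smooth_const)
  have hom: "jet r \<in> ring_hom ?S Q"
    using I.rcos_ring_hom by (simp add: jet_def[abs_def] Q_def)
  have jet_const: "jet r (\<lambda>u. c) \<in> carrier Q" for c :: real
    using hom const by (rule ring_hom_closed)
  have jet_const_add: "jet r (\<lambda>u. c + d) = jet r (\<lambda>u. c) \<oplus>\<^bsub>Q\<^esub> jet r (\<lambda>u. d)" for c d :: real
    using ring_hom_add[OF hom const[of c] const[of d]] by (simp add: smooth_ring_def)
  have jet_const_mult: "jet r (\<lambda>u. c * d) = jet r (\<lambda>u. c) \<otimes>\<^bsub>Q\<^esub> jet r (\<lambda>u. d)" for c d :: real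
    using ring_hom_mult[OF hom const[of c] const[of d]] by (simp add: smooth_ring_def)
  have jet_one: "jet r (\<lambda>u. 1) = \<one>\<^bsub>Q\<^esub>"
    using ring_hom_one[OF hom] by (simp add: smooth_ring_def)
  have A: "jet_algebra r = \<lparr>carrier = carrier Q, mult = mult Q, one = one Q, zero = zero Q,
      add = add Q, smult = (\<lambda>c a. jet r (\<lambda>u. c) \<otimes>\<^bsub>Q\<^esub> a)\<rparr>"
    by (simp add: jet_algebra_def Q_def Let_def)
  have "cring (jet_algebra r :: (real, (real^'a \<Rightarrow> real) set) module)"
  proof (rule cringI)
    show "abelian_group (jet_algebra r :: (real, (real^'a \<Rightarrow> real) set) module)"
      by (rule abelian_groupI) (auto simp: A Q.add.m_ac intro: Q.l_neg)
    show "comm_monoid (jet_algebra r :: (real, (real^'a \<Rightarrow> real) set) module)"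
      by (rule comm_monoidI) (auto simp: A Q.m_ac)
  qed (auto simp: A Q.l_distr)
  then show "Module.algebra real_field (jet_algebra r :: (real, (real^'a \<Rightarrow> real) set) module)"
    by (rule Module.algebraI[OF cring_from_type_algebra])
      (simp_all add: A jet_const jet_const_add jet_const_mult jet_one
        Q.l_distr Q.r_distr Q.m_assoc)
qed

end

(*
A form F is the same as a linear functional d da_1 ... da_s -> F(a_1, ..., a_s)(d) on the Kaehler
s-forms of the jet algebra.  These are the polynomial s-forms modulo coefficients of degree > r and
modulo d(x^g) dx^J for |g| = r + 1.

Injectivity: by the derivation rule, F is determined by the values F(x^I)(x^a) on coordinates and
monomials, and by skew symmetry I may be taken increasing.  If |a| = r and m = last I is at least
the largest variable of x^a, then 0 = d(x^a x^m) dx^(I - m) expresses x^a dx^I by forms x^b dx^L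
with m the largest variable of x^b and all entries of L smaller than m.

Surjectivity: there is a dual basis.  For |a| < r take the coefficient of x^a dx^I.  For |a| = r,
with m the largest variable of x^a, take the coefficient of x^(a - e_m) dx^m dx^I in the exterior
derivative and divide it by a_m; since every index of I is smaller than m, among the elements of Z
it only sees (I, a).
*)
theory Submission
  imports Defs
begin

section \<open>Partial derivatives and Taylor polynomials\<close>

text \<open>Partial derivatives do not act on jets of order r: they lower the order by one. Forms
  are therefore pulled back to smooth functions, where Jacobians make sense, and independence of the
  chosen representatives becomes a separate obligation, \<open>jet_cong\<close>. In degree r the
  relations are precisely the exact forms. By the polynomial Poincare lemma, dividing by them is
  dividing by the kernel of the exterior derivative, so every functional on the quotient factors
  through that derivative; this is where the top half of the dual basis comes from. The condition on
  the last index in Z selects a complement of the exact forms. The derivative of x^a dx^I contains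
  a_m x^(a - e_m) dx^m dx^I, whence the normalising factor 1 / a_m. Both halves divide by a positive
  exponent, a_m + 1 for injectivity and a_m for surjectivity, which uses characteristic 0.\<close>

lemma partial_deriv_line:
  assumes "\<And>u. f differentiable (at u)"
  shows "((\<lambda>t. f (v + t *\<^sub>R axis i 1)) has_real_derivative
    partial_deriv i f (v + t *\<^sub>R axis i 1)) (at t)"
proof -
  let ?w = "v + t *\<^sub>R axis i 1"
  have line: "((\<lambda>t. v + t *\<^sub>R axis i 1) has_derivative (\<lambda>h. h *\<^sub>R axis i 1)) (at t)"
    by (auto intro!: derivative_eq_intros)
  have f: "(f has_derivative frechet_derivative f (at ?w)) (at ?w)"
    using assms by (simp flip: frechet_derivative_works)
  interpret linear "frechet_derivative f (at ?w)"
    using f has_derivative_linear by blast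
  have "(\<lambda>h. frechet_derivative f (at ?w) (h *\<^sub>R axis i 1)) = (*) (partial_deriv i f ?w)"
    by (auto simp: partial_deriv_def scale)
  with has_derivative_compose[OF line f] show ?thesis
    by (simp add: has_field_derivative_def)
qed

text \<open>The mean value theorem is applied twice: in direction \<open>i\<close> to the difference
  of \<open>f\<close> on two parallel lines, then in direction \<open>j\<close> to
  \<open>partial_deriv i f\<close>.\<close>

lemma second_difference_mvt:
  fixes f :: "real^'k::finite \<Rightarrow> real"
  assumes "smooth f" "h > 0"
  shows "\<exists>a b. 0 < a \<and> a < h \<and> 0 < b \<and> b < h \<and>
    f (u + h *\<^sub>R axis i 1 + h *\<^sub>R axis j 1) - f (u + h *\<^sub>R axis i 1) - f (u + h *\<^sub>R axis j 1) + f u =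
    h * h * partial_deriv j (partial_deriv i f) (u + a *\<^sub>R axis i 1 + b *\<^sub>R axis j 1)"
proof -
  note f = smoothD(1)[OF assms(1)] and fi = smoothD(1)[OF smoothD(2)[OF assms(1)]]
  have "\<exists>a>0. a < h \<and>
      (f (u + h *\<^sub>R axis j 1 + h *\<^sub>R axis i 1) - f (u + h *\<^sub>R axis i 1)) -
      (f (u + h *\<^sub>R axis j 1 + 0 *\<^sub>R axis i 1) - f (u + 0 *\<^sub>R axis i 1)) =
      (h - 0) * (partial_deriv i f (u + h *\<^sub>R axis j 1 + a *\<^sub>R axis i 1) -
        partial_deriv i f (u + a *\<^sub>R axis i 1))"
    by (rule MVT2[OF assms(2)]) (rule DERIV_diff partial_deriv_line f)+
  then obtain a where a: "0 < a" "a < h" and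
    1: "f (u + h *\<^sub>R axis i 1 + h *\<^sub>R axis j 1) - f (u + h *\<^sub>R axis i 1) - f (u + h *\<^sub>R axis j 1) + f u =
      h * (partial_deriv i f (u + a *\<^sub>R axis i 1 + h *\<^sub>R axis j 1) -
        partial_deriv i f (u + a *\<^sub>R axis i 1))"
    by (auto simp: add_ac)
  have "\<exists>b>0. b < h \<and> partial_deriv i f (u + a *\<^sub>R axis i 1 + h *\<^sub>R axis j 1) -
      partial_deriv i f (u + a *\<^sub>R axis i 1 + 0 *\<^sub>R axis j 1) =
      (h - 0) * partial_deriv j (partial_deriv i f) (u + a *\<^sub>R axis i 1 + b *\<^sub>R axis j 1)"
    by (rule MVT2[OF assms(2)]) (rule partial_deriv_line fi)+
  with a 1 show ?thesis by auto
qed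

text \<open>Schwarz's theorem. The second difference is symmetric in \<open>i\<close> and
  \<open>j\<close>, so both mixed derivatives take a common value at points arbitrarily close to
  \<open>u\<close>, and continuity forces them to agree at \<open>u\<close>.\<close>

lemma partial_deriv_commute:
  fixes f :: "real^'k::finite \<Rightarrow> real"
  assumes "smooth f"
  shows "partial_deriv i (partial_deriv j f) = partial_deriv j (partial_deriv i f)"
proof (rule ext, rule ccontr)
  fix u
  let ?A = "partial_deriv i (partial_deriv j f)" and ?B = "partial_deriv j (partial_deriv i f)"
  assume ne: "?A u \<noteq> ?B u"
  \<comment> \<open>Half the gap: a common value cannot lie strictly within \<open>e\<close> of both
    \<open>?A u\<close> and \<open>?B u\<close>.\<close>
  define e where "e = \<bar>?A u - ?B u\<bar> / 2"
  have e: "e > 0" using ne by (simp add: e_def)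
  have "isCont ?A u" "isCont ?B u"
    using assms by (auto intro!: differentiable_imp_continuous_within smoothD)
  then obtain d1 d2 where d: "d1 > 0" "\<And>x. dist x u < d1 \<Longrightarrow> dist (?A x) (?A u) < e"
      "d2 > 0" "\<And>x. dist x u < d2 \<Longrightarrow> dist (?B x) (?B u) < e"
    using e unfolding continuous_at_eps_delta by metis
  \<comment> \<open>Both displacements lie strictly between 0 and \<open>h\<close>, so the points
    stay within \<open>2 * h = min d1 d2\<close> of \<open>u\<close>.\<close>
  define h where "h = min d1 d2 / 2"
  have h: "h > 0" using d by (simp add: h_def)
  obtain a b where ab: "0 < a" "a < h" "0 < b" "b < h" and
    1: "f (u + h *\<^sub>R axis i 1 + h *\<^sub>R axis j 1) - f (u + h *\<^sub>R axis i 1) - f (u + h *\<^sub>R axis j 1) + f u =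
    h * h * ?B (u + a *\<^sub>R axis i 1 + b *\<^sub>R axis j 1)"
    using second_difference_mvt[OF assms h, of u i j] by blast
  obtain a' b' where ab': "0 < a'" "a' < h" "0 < b'" "b' < h" and
    2: "f (u + h *\<^sub>R axis j 1 + h *\<^sub>R axis i 1) - f (u + h *\<^sub>R axis j 1) - f (u + h *\<^sub>R axis i 1) + f u =
    h * h * ?A (u + a' *\<^sub>R axis j 1 + b' *\<^sub>R axis i 1)"
    using second_difference_mvt[OF assms h, of u j i] by blast
  have eq: "?B (u + a *\<^sub>R axis i 1 + b *\<^sub>R axis j 1) = ?A (u + a' *\<^sub>R axis j 1 + b' *\<^sub>R axis i 1)"
  proof -
    have "f (u + h *\<^sub>R axis i 1 + h *\<^sub>R axis j 1) = f (u + h *\<^sub>R axis j 1 + h *\<^sub>R axis i 1)"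
      by (simp add: add_ac)
    with 1 2 have "h * h * ?B (u + a *\<^sub>R axis i 1 + b *\<^sub>R axis j 1) =
        h * h * ?A (u + a' *\<^sub>R axis j 1 + b' *\<^sub>R axis i 1)" by linarith
    with h show ?thesis by simp
  qed
  have near: "dist (u + x *\<^sub>R axis k 1 + y *\<^sub>R axis l 1) u < min d1 d2"
    if "0 < x" "x < h" "0 < y" "y < h" for x y and k l :: 'k
  proof -
    have "norm (x *\<^sub>R axis k 1 + y *\<^sub>R axis l 1 :: real^'k) \<le> x + y"
      by (rule norm_triangle_le) (use that in simp)
    then show ?thesis using that by (simp add: dist_norm h_def add_ac field_simps)
  qed
  have "dist (?B (u + a *\<^sub>R axis i 1 + b *\<^sub>R axis j 1)) (?B u) < e"
    using near[OF ab] by (intro d) auto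
  moreover have "dist (?A (u + a' *\<^sub>R axis j 1 + b' *\<^sub>R axis i 1)) (?A u) < e"
    using near[OF ab'] by (intro d) auto
  ultimately show False
    using eq by (simp add: dist_real_def e_def abs_if split: if_splits)
qed

section \<open>Linearity of iterated derivatives and independence of their order\<close>

lemma smooth_cmult: "smooth f \<Longrightarrow> smooth (\<lambda>u. c * f u)"
  by (intro smooth_mult smooth_const)

lemma smooth_sum: "(\<And>x. x \<in> S \<Longrightarrow> smooth (f x)) \<Longrightarrow> smooth (\<lambda>u. \<Sum>x\<in>S. f x u)"
  by (induction S rule: infinite_finite_induct) (auto intro: smooth_const smooth_add)

lemma smooth_prod: "(\<And>x. x \<in> S \<Longrightarrow> smooth (f x)) \<Longrightarrow> smooth (\<lambda>u. \<Prod>x\<in>S. f x u)"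
  by (induction S rule: infinite_finite_induct) (auto intro: smooth_const smooth_mult)

lemma smooth_power: "smooth f \<Longrightarrow> smooth (\<lambda>u. f u ^ n)"
  by (induction n) (auto intro: smooth_const smooth_mult)

lemma partial_deriv_cmult:
  assumes "\<And>u. f differentiable (at u)"
  shows "partial_deriv i (\<lambda>u. c * f u) = (\<lambda>u. c * partial_deriv i f u)"
  by (subst partial_deriv_mult) (auto simp: assms partial_deriv_const)

lemma iter_partial_cmult:
  "smooth f \<Longrightarrow> iter_partial xs (\<lambda>u. c * f u) = (\<lambda>u. c * iter_partial xs f u)"
  by (induction xs arbitrary: f) (simp_all add: partial_deriv_cmult smoothD)

lemma iter_partial_sum:
  assumes "\<And>x. x \<in> S \<Longrightarrow> smooth (f x)"
  shows "iter_partial xs (\<lambda>u. \<Sum>x\<in>S. f x u) = (\<lambda>u. \<Sum>x\<in>S. iter_partial xs (f x) u)"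
  using assms
  by (induction S rule: infinite_finite_induct)
    (simp_all add: iter_partial_zero iter_partial_add smooth_sum)

lemma iter_partial_partial_deriv:
  "smooth f \<Longrightarrow> iter_partial xs (partial_deriv i f) = partial_deriv i (iter_partial xs f)"
  by (induction xs arbitrary: f) (simp_all add: partial_deriv_commute[of _ _ i] smoothD)

lemma iter_partial_append: "iter_partial (xs @ ys) f = iter_partial ys (iter_partial xs f)"
  by (induction xs arbitrary: f) simp_all

text \<open>The first direction of \<open>xs\<close> is moved through \<open>ys\<close> by commuting
  derivatives. This allows words of directions to be replaced by multi-indices.\<close>

lemma iter_partial_mset_cong:
  "smooth f \<Longrightarrow> mset xs = mset ys \<Longrightarrow> iter_partial xs f = iter_partial ys f"
proof (induction xs arbitrary: f ys)
  case (Cons x xs)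
  then have "x \<in> set ys" by (metis list.set_intros(1) mset_eq_setD)
  then obtain as bs where ys: "ys = as @ x # bs" by (metis split_list)
  have "iter_partial xs (partial_deriv x f) = iter_partial (as @ bs) (partial_deriv x f)"
    using Cons.prems by (intro Cons.IH) (auto simp: ys smoothD)
  with Cons.prems show ?case
    by (simp add: ys iter_partial_append iter_partial_partial_deriv)
qed simp

section \<open>Monomials, Taylor coefficients and Taylor polynomials of jets\<close>

definition monomial :: "('k::finite \<Rightarrow> nat) \<Rightarrow> real^'k \<Rightarrow> real"
  where "monomial \<alpha> u = (\<Prod>i\<in>UNIV. (u $ i) ^ \<alpha> i)"

lemma smooth_monomial: "smooth (monomial \<alpha>)"
  unfolding monomial_def[abs_def] by (intro smooth_prod smooth_power smooth_coord)

lemma monomial_upd_Suc: "monomial (\<alpha>(i := Suc (\<alpha> i))) u = u $ i * monomial \<alpha> u"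
  unfolding monomial_def by (subst (1 2) prod.remove[of _ i]) auto

lemma monomial_0: "monomial (\<lambda>_. 0) = (\<lambda>u. 1)"
  by (simp add: monomial_def fun_eq_iff)

text \<open>For \<open>\<alpha> i = 0\<close> the truncated subtraction leaves the exponent
  unchanged, but the factor \<open>real (\<alpha> i)\<close> vanishes.\<close>

lemma partial_deriv_monomial:
  "partial_deriv i (monomial \<alpha>) = (\<lambda>u. real (\<alpha> i) * monomial (\<alpha>(i := \<alpha> i - 1)) u)"
proof
  fix u :: "real^'a"
  let ?C = "\<Prod>j\<in>UNIV - {i}. (u $ j) ^ \<alpha> j"
  have "monomial \<alpha> (u + t *\<^sub>R axis i 1) = (u $ i + t) ^ \<alpha> i * ?C" for t
    unfolding monomial_def by (subst prod.remove[of _ i]) (auto simp: axis_def intro!: prod.cong)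
  then have "((\<lambda>t. monomial \<alpha> (u + t *\<^sub>R axis i 1)) has_real_derivative
      real (\<alpha> i) * (u $ i + 0) ^ (\<alpha> i - 1) * ?C) (at 0)"
    by (auto intro!: derivative_eq_intros)
  from DERIV_unique[OF this partial_deriv_line[OF smoothD(1)[OF smooth_monomial]]]
  show "partial_deriv i (monomial \<alpha>) u = real (\<alpha> i) * monomial (\<alpha>(i := \<alpha> i - 1)) u"
    unfolding monomial_def by (subst prod.remove[of _ i]) (auto simp: mult.assoc)
qed

text \<open>Too few derivatives in some variable leave a factor that vanishes at 0, too many
  annihilate the monomial; an exact match produces the factorials.\<close>

lemma iter_partial_monomial:
  "iter_partial xs (monomial \<alpha>) 0 = (if count_list xs = \<alpha> then \<Prod>i\<in>UNIV. fact (\<alpha> i) else 0)"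
proof (induction xs arbitrary: \<alpha>)
  case Nil
  show ?case
    by (auto simp: monomial_def fun_eq_iff power_0_left)
next
  case (Cons x xs)
  let ?\<alpha>' = "\<alpha>(x := \<alpha> x - 1)"
  \<comment> \<open>The condition \<open>\<alpha> x \<noteq> 0\<close> is essential: with truncated
    subtraction, \<open>?\<alpha>'\<close> would otherwise equal \<open>\<alpha>\<close>.\<close>
  have eq: "count_list (x # xs) = \<alpha> \<longleftrightarrow> \<alpha> x \<noteq> 0 \<and> count_list xs = ?\<alpha>'"
    by (auto simp: fun_eq_iff)
  have "iter_partial (x # xs) (monomial \<alpha>) 0 = real (\<alpha> x) * iter_partial xs (monomial ?\<alpha>') 0"
    by (simp add: partial_deriv_monomial iter_partial_cmult smooth_monomial)
  moreover have "real (\<alpha> x) * (\<Prod>i\<in>UNIV. fact (?\<alpha>' i)) = (\<Prod>i\<in>UNIV. fact (\<alpha> i))" if "\<alpha> x \<noteq> 0"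
    by (subst (1 2) prod.remove[of _ x]) (use that in \<open>auto simp: fact_reduce mult.assoc\<close>)
  ultimately show ?case
    unfolding eq Cons.IH[of ?\<alpha>'] by simp
qed

text \<open>Iterated derivatives are indexed by lists, so a multi-index needs a list that realises
  it. By \<open>iter_partial_mset_cong\<close> the choice does not affect derivatives of smooth
  functions.\<close>

definition multi_word :: "('k::finite \<Rightarrow> nat) \<Rightarrow> 'k list"
  where "multi_word \<alpha> = (SOME xs. count_list xs = \<alpha>)"

lemma count_list_multi_word: "count_list (multi_word \<alpha>) = \<alpha>"
proof -
  obtain xs where "mset xs = Abs_multiset \<alpha>" using ex_mset by blast
  then have "count_list xs = \<alpha>"
    by (auto simp: fun_eq_iff simp flip: count_mset)
  then show ?thesis unfolding multi_word_def by (rule someI)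
qed

lemma length_eq_sum_count_list: "length xs = sum (count_list xs) (UNIV :: 'k::finite set)"
  proof (induction xs)
  case (Cons x xs)
  have "count_list (x # xs) = (\<lambda>y. count_list xs y + (if x = y then 1 else 0))"
    by auto
  with Cons show ?case
    by (simp add: sum.distrib)
qed simp

definition taylor_coeff :: "('k::finite \<Rightarrow> nat) \<Rightarrow> (real^'k \<Rightarrow> real) \<Rightarrow> real"
  where "taylor_coeff \<alpha> f = iter_partial (multi_word \<alpha>) f 0 / (\<Prod>i\<in>UNIV. fact (\<alpha> i))"

lemma taylor_coeff_monomial: "taylor_coeff \<beta> (monomial \<alpha>) = (if \<alpha> = \<beta> then 1 else 0)"
  by (auto simp: taylor_coeff_def iter_partial_monomial count_list_multi_word)

lemma taylor_coeff_add: "smooth f \<Longrightarrow> smooth g \<Longrightarrow> taylor_coeff \<beta> (\<lambda>u. f u + g u) = taylor_coeff \<beta> f + taylor_coeff \<beta> g"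
  by (simp add: taylor_coeff_def iter_partial_add add_divide_distrib)

lemma taylor_coeff_cmult: "smooth f \<Longrightarrow> taylor_coeff \<beta> (\<lambda>u. c * f u) = c * taylor_coeff \<beta> f"
  by (simp add: taylor_coeff_def iter_partial_cmult)

lemma taylor_coeff_sum:
  "(\<And>x. x \<in> S \<Longrightarrow> smooth (f x)) \<Longrightarrow> taylor_coeff \<beta> (\<lambda>u. \<Sum>x\<in>S. f x u) = (\<Sum>x\<in>S. taylor_coeff \<beta> (f x))"
  by (simp add: taylor_coeff_def iter_partial_sum sum_divide_distrib)

lemma finite_multi_indices: "finite {\<alpha> :: 'k::finite \<Rightarrow> nat. sum \<alpha> UNIV \<le> r}"
proof (rule finite_subset)
  show "{\<alpha> :: 'k \<Rightarrow> nat. sum \<alpha> UNIV \<le> r} \<subseteq> (UNIV \<rightarrow>\<^sub>E {..r})"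
    by (auto simp: PiE_def extensional_def) (meson finite iso_tuple_UNIV_I member_le_sum order_trans zero_le)
qed (intro finite_PiE; simp)

text \<open>Jets only see derivatives at 0. Differentiating the Taylor polynomial along
  \<open>xs\<close> kills every monomial except the one with exponent \<open>count_list xs\<close>,
  which occurs in the sum because \<open>length xs \<le> r\<close>.\<close>

lemma jet_taylor:
  assumes "smooth f"
  shows "jet r f = jet r (\<lambda>u. \<Sum>\<alpha> | sum \<alpha> UNIV \<le> r. taylor_coeff \<alpha> f * monomial \<alpha> u)"
proof -
  have "iter_partial xs f 0 =
      iter_partial xs (\<lambda>u. \<Sum>\<alpha> | sum \<alpha> UNIV \<le> r. taylor_coeff \<alpha> f * monomial \<alpha> u) 0" if "length xs \<le> r" for xs
  proof -
    have "iter_partial xs (\<lambda>u. \<Sum>\<alpha> | sum \<alpha> UNIV \<le> r. taylor_coeff \<alpha> f * monomial \<alpha> u) 0 =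
        (\<Sum>\<alpha> | sum \<alpha> UNIV \<le> r. taylor_coeff \<alpha> f * iter_partial xs (monomial \<alpha>) 0)"
      by (simp add: iter_partial_sum iter_partial_cmult smooth_cmult smooth_monomial)
    also have "\<dots> = (\<Sum>\<alpha> | sum \<alpha> UNIV \<le> r. if count_list xs = \<alpha> then iter_partial (multi_word \<alpha>) f 0 else 0)"
      by (intro sum.cong) (auto simp: iter_partial_monomial taylor_coeff_def)
    also have "\<dots> = iter_partial (multi_word (count_list xs)) f 0"
      using that by (subst sum.delta'[OF finite_multi_indices]) (simp add: length_eq_sum_count_list)
    also have "\<dots> = iter_partial xs f 0"
      using assms by (intro fun_cong[OF iter_partial_mset_cong] multiset_eqI)
        (simp_all add: count_mset count_list_multi_word)
    finally show ?thesis by simp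
  qed
  then show ?thesis
    using assms by (subst jet_eq_iff) (auto intro!: smooth_sum smooth_cmult smooth_monomial)
qed


section \<open>Forms on jets as forms on smooth functions\<close>

lemma carrier_jet_algebra: "carrier (jet_algebra r) = jet r ` Collect smooth"
  by (auto simp: jet_algebra_def Let_def FactRing_def A_RCOSETS_def' smooth_ring_def jet_def)

lemma jet_ring_hom: "jet r \<in> ring_hom smooth_ring (smooth_ring Quot flat_ideal r)"
  using ideal.rcos_ring_hom[OF ideal_flat_ideal] by (simp add: jet_def[abs_def])

lemma jet_add:
  "smooth f \<Longrightarrow> smooth g \<Longrightarrow> jet r f \<oplus>\<^bsub>jet_algebra r\<^esub> jet r g = jet r (\<lambda>u. f u + g u)"
  using ring_hom_add[OF jet_ring_hom, of f g r]
  by (simp add: jet_algebra_def Let_def smooth_ring_def)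

lemma jet_mult:
  "smooth f \<Longrightarrow> smooth g \<Longrightarrow> jet r f \<otimes>\<^bsub>jet_algebra r\<^esub> jet r g = jet r (\<lambda>u. f u * g u)"
  using ring_hom_mult[OF jet_ring_hom, of f g r]
  by (simp add: jet_algebra_def Let_def smooth_ring_def)

lemma jet_smult: "smooth f \<Longrightarrow> c \<odot>\<^bsub>jet_algebra r\<^esub> jet r f = jet r (\<lambda>u. c * f u)"
  using jet_mult[OF smooth_const, of f r c] by (simp add: jet_algebra_def Let_def)

lemma jet_one: "\<one>\<^bsub>jet_algebra r\<^esub> = jet r (\<lambda>u::real^'k::finite. 1)"
proof -
  have "\<one>\<^bsub>smooth_ring\<^esub> = (\<lambda>u::real^'k. 1)"
    by (simp add: smooth_ring_def)
  moreover have "jet r (\<one>\<^bsub>smooth_ring\<^esub> :: real^'k \<Rightarrow> real) = \<one>\<^bsub>smooth_ring Quot flat_ideal r\<^esub>"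
    by (rule ring_hom_one[OF jet_ring_hom])
  ultimately show ?thesis
    by (simp add: jet_algebra_def Let_def)
qed

lemma jet_in_carrier: "smooth f \<Longrightarrow> jet r f \<in> carrier (jet_algebra r)"
  by (simp add: carrier_jet_algebra)

lemma jet_power:
  "smooth f \<Longrightarrow> jet r f [^]\<^bsub>jet_algebra r\<^esub> (n::nat) = jet r (\<lambda>u. f u ^ n)"
proof (induction n)
  case 0
  then show ?case by (simp add: nat_pow_def jet_one)
next
  case (Suc n)
  then show ?case
    by (simp add: nat_pow_def jet_mult smooth_power mult.commute)
qed

lemma jet_monom_eq: "jet_monom r \<alpha> = jet r (monomial \<alpha>)"
proof -
  interpret A: algebra real_field "jet_algebra r" by (rule algebra_jet_algebra)
  have "(\<Otimes>\<^bsub>jet_algebra r\<^esub>i\<in>S. jet_coord r i [^]\<^bsub>jet_algebra r\<^esub> \<alpha> i) =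
      jet r (\<lambda>u. \<Prod>i\<in>S. (u $ i) ^ \<alpha> i)" if "finite S" for S
    using that
  proof (induction S rule: finite_induct)
    case (insert i S)
    have "(\<lambda>i. jet_coord r i [^]\<^bsub>jet_algebra r\<^esub> \<alpha> i) \<in> S \<rightarrow> carrier (jet_algebra r)"
      by (auto simp: jet_coord_def jet_power smooth_coord intro!: jet_in_carrier smooth_power)
    with insert show ?case
      by (simp add: A.finprod_insert jet_coord_def jet_power smooth_coord jet_mult jet_in_carrier
          smooth_power smooth_prod)
  qed (simp add: jet_one)
  then show ?thesis
    by (simp add: jet_monom_def monomial_def[abs_def])
qed

text \<open>A word of length at most \<open>r\<close> cannot have counts of total degree above
  \<open>r\<close>. This nilpotency is the source of the linear relations in degree
  \<open>r\<close>.\<close>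

lemma jet_monomial_eq_0:
  assumes "r < sum \<alpha> UNIV"
  shows "jet r (monomial \<alpha>) = jet r (\<lambda>u. 0)"
proof (subst jet_eq_iff[OF smooth_monomial smooth_const], intro allI impI)
  fix xs :: "'a list" assume "length xs \<le> r"
  with assms have "count_list xs \<noteq> \<alpha>"
    using length_eq_sum_count_list[of xs] by auto
  then show "iter_partial xs (monomial \<alpha>) 0 = iter_partial xs (\<lambda>u. 0) 0"
    by (simp add: iter_partial_monomial iter_partial_zero)
qed

lemma set_list_update_smooth:
  "set fs \<subseteq> Collect smooth \<Longrightarrow> smooth f \<Longrightarrow> set (fs[t := f]) \<subseteq> Collect smooth"
  by (meson mem_Collect_eq set_update_subsetI)

text \<open>
  The forms on the jet algebra, pulled back along \<^const>\<open>jet\<close> to functions of smooth functions.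
\<close>
locale smooth_form =
  fixes r s :: nat and G :: "(real^'k::finite \<Rightarrow> real) list \<Rightarrow> (real^'k \<Rightarrow> real) \<Rightarrow> real"
  assumes jet_cong: "\<lbrakk>length fs = s; set fs \<subseteq> Collect smooth; set gs \<subseteq> Collect smooth;
      smooth f; smooth g; map (jet r) fs = map (jet r) gs; jet r f = jet r g\<rbrakk> \<Longrightarrow> G fs f = G gs g"
    and add: "\<lbrakk>length fs = s; set fs \<subseteq> Collect smooth; smooth f; smooth g\<rbrakk> \<Longrightarrow>
      G fs (\<lambda>u. f u + g u) = G fs f + G fs g"
    and scale: "\<lbrakk>length fs = s; set fs \<subseteq> Collect smooth; smooth f\<rbrakk> \<Longrightarrow>
      G fs (\<lambda>u. c * f u) = c * G fs f"
    and slot_add: "\<lbrakk>length fs = s; set fs \<subseteq> Collect smooth; t < s; smooth f; smooth g; smooth h\<rbrakk> \<Longrightarrow>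
      G (fs[t := \<lambda>u. f u + g u]) h = G (fs[t := f]) h + G (fs[t := g]) h"
    and slot_scale: "\<lbrakk>length fs = s; set fs \<subseteq> Collect smooth; t < s; smooth f; smooth h\<rbrakk> \<Longrightarrow>
      G (fs[t := \<lambda>u. c * f u]) h = c * G (fs[t := f]) h"
    and skew: "\<lbrakk>length fs = s; set fs \<subseteq> Collect smooth; p < s; q < s; p \<noteq> q; smooth f\<rbrakk> \<Longrightarrow>
      G (fs[p := fs ! q, q := fs ! p]) f = - G fs f"
    and leibniz: "\<lbrakk>length fs = s; set fs \<subseteq> Collect smooth; t < s; smooth f; smooth g; smooth h\<rbrakk> \<Longrightarrow>
      G (fs[t := \<lambda>u. f u * g u]) h =
      G (fs[t := f]) (\<lambda>u. g u * h u) + G (fs[t := g]) (\<lambda>u. f u * h u)"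

lemma map_jet_in_tuples:
  "length fs = s \<Longrightarrow> set fs \<subseteq> Collect smooth \<Longrightarrow> map (jet r) fs \<in> tuples (jet_algebra r) s"
  by (auto simp: tuples_def intro: jet_in_carrier)

text \<open>Every element of the jet algebra is the jet of a smooth function, and its operations are
  pointwise on representatives, so each law of a form pulls back to the corresponding law of the
  locale.\<close>

lemma smooth_form_of_form:
  fixes F :: "(real^'k::finite \<Rightarrow> real) set list \<Rightarrow> (real^'k \<Rightarrow> real) set \<Rightarrow> real"
  assumes "F \<in> carrier (forms (jet_algebra r) s)"
  shows "smooth_form r s (\<lambda>fs f. F (map (jet r) fs) (jet r f))"
proof -
  let ?A = "jet_algebra r :: (real, (real^'k \<Rightarrow> real) set) module"
  from assms have F: "F \<in> multilinear_maps ?A s" "skew_symmetric ?A s F" "derivation_like ?A s F"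
    by (auto simp: forms_def)
  note tuple = map_jet_in_tuples[of _ s r] and carr = jet_in_carrier[of _ r]
  have dual: "F v \<in> dual ?A" if "v \<in> tuples ?A s" for v
    using F(1) that by (simp add: multilinear_maps_def)
  show ?thesis
  proof
    fix fs gs :: "(real^'k \<Rightarrow> real) list" and f g :: "real^'k \<Rightarrow> real"
    assume "map (jet r) fs = map (jet r) gs" "jet r f = jet r g"
    then show "F (map (jet r) fs) (jet r f) = F (map (jet r) gs) (jet r g)" by simp
  next
    fix fs :: "(real^'k \<Rightarrow> real) list" and f g :: "real^'k \<Rightarrow> real" assume a: "length fs = s" "set fs \<subseteq> Collect smooth" "smooth f" "smooth g"
    then show "F (map (jet r) fs) (jet r (\<lambda>u. f u + g u)) =
        F (map (jet r) fs) (jet r f) + F (map (jet r) fs) (jet r g)"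
      using dual[OF tuple[OF a(1,2)]] by (simp add: dual_def carr flip: jet_add)
  next
    fix fs :: "(real^'k \<Rightarrow> real) list" and c and f :: "real^'k \<Rightarrow> real" assume a: "length fs = s" "set fs \<subseteq> Collect smooth" "smooth f"
    then show "F (map (jet r) fs) (jet r (\<lambda>u. c * f u)) = c * F (map (jet r) fs) (jet r f)"
      using dual[OF tuple[OF a(1,2)]] by (simp add: dual_def carr flip: jet_smult)
  next
    fix fs :: "(real^'k \<Rightarrow> real) list" and t and f g h :: "real^'k \<Rightarrow> real"
    assume a: "length fs = s" "set fs \<subseteq> Collect smooth" "t < s" "smooth f" "smooth g" "smooth h"
    then show "F (map (jet r) (fs[t := \<lambda>u. f u + g u])) (jet r h) =
        F (map (jet r) (fs[t := f])) (jet r h) + F (map (jet r) (fs[t := g])) (jet r h)"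
      using F(1) tuple[OF a(1,2)]
      by (simp add: multilinear_maps_def carr map_update flip: jet_add)
    from a show "F (map (jet r) (fs[t := \<lambda>u. f u * g u])) (jet r h) =
        F (map (jet r) (fs[t := f])) (jet r (\<lambda>u. g u * h u)) +
        F (map (jet r) (fs[t := g])) (jet r (\<lambda>u. f u * h u))"
      using F(3) tuple[OF a(1,2)]
      by (simp add: derivation_like_def carr map_update flip: jet_mult)
  next
    fix fs :: "(real^'k \<Rightarrow> real) list" and t c and f h :: "real^'k \<Rightarrow> real"
    assume a: "length fs = s" "set fs \<subseteq> Collect smooth" "t < s" "smooth f" "smooth h"
    then show "F (map (jet r) (fs[t := \<lambda>u. c * f u])) (jet r h) =
        c * F (map (jet r) (fs[t := f])) (jet r h)"
      using F(1) tuple[OF a(1,2)]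
      by (simp add: multilinear_maps_def carr map_update flip: jet_smult)
  next
    fix fs :: "(real^'k \<Rightarrow> real) list" and p q and f :: "real^'k \<Rightarrow> real"
    assume a: "length fs = s" "set fs \<subseteq> Collect smooth" "p < s" "q < s" "p \<noteq> q" "smooth f"
    then have "map (jet r) (fs[p := fs ! q, q := fs ! p]) =
        (map (jet r) fs)[p := map (jet r) fs ! q, q := map (jet r) fs ! p]"
      by (simp add: map_update)
    then show "F (map (jet r) (fs[p := fs ! q, q := fs ! p])) (jet r f) =
        - F (map (jet r) fs) (jet r f)"
      using F(2)[unfolded skew_symmetric_def, rule_format, OF tuple[OF a(1,2)] a(3-5) carr[OF a(6)]]
      by simp
  qed
qed

section \<open>Descent from smooth functions to jets\<close>

definition jet_rep :: "nat \<Rightarrow> (real^'k::finite \<Rightarrow> real) set \<Rightarrow> real^'k \<Rightarrow> real"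
  where "jet_rep r = inv_into (Collect smooth) (jet r)"

lemma jet_rep:
  assumes "a \<in> carrier (jet_algebra r)"
  shows "smooth (jet_rep r a)" "jet r (jet_rep r a) = a"
proof -
  from assms have "a \<in> jet r ` Collect smooth" by (simp add: carrier_jet_algebra)
  from inv_into_into[OF this] f_inv_into_f[OF this]
  show "smooth (jet_rep r a)" "jet r (jet_rep r a) = a"
    by (simp_all add: jet_rep_def)
qed

text \<open>The value 0 off the carriers matches the convention in \<open>dual\<close> and
  \<open>multilinear_maps\<close>.\<close>

definition lift_form ::
    "nat \<Rightarrow> nat \<Rightarrow> ((real^'k::finite \<Rightarrow> real) list \<Rightarrow> (real^'k \<Rightarrow> real) \<Rightarrow> real) \<Rightarrow>
      (real^'k \<Rightarrow> real) set list \<Rightarrow> (real^'k \<Rightarrow> real) set \<Rightarrow> real"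
  where "lift_form r s G v d =
    (if v \<in> tuples (jet_algebra r) s \<and> d \<in> carrier (jet_algebra r)
     then G (map (jet_rep r) v) (jet_rep r d) else 0)"

context smooth_form
begin

text \<open>Here \<open>jet_cong\<close> removes the dependence on the representatives chosen by
  \<open>jet_rep\<close>; the laws of a form can then be checked on arbitrary
  representatives.\<close>

lemma lift_form_jet:
  assumes "length fs = s" "set fs \<subseteq> Collect smooth" "smooth f"
  shows "lift_form r s G (map (jet r) fs) (jet r f) = G fs f"
proof -
  have "G (map (jet_rep r) (map (jet r) fs)) (jet_rep r (jet r f)) = G fs f"
    using assms by (intro jet_cong) (auto simp: jet_rep jet_in_carrier)
  then show ?thesis
    using assms by (simp add: lift_form_def map_jet_in_tuples jet_in_carrier)
qed

lemma tuples_jetE: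
  assumes "v \<in> tuples (jet_algebra r) s"
  obtains fs :: "(real^'k \<Rightarrow> real) list"
  where "v = map (jet r) fs" "length fs = s" "set fs \<subseteq> Collect smooth"
proof
  show "v = map (jet r) (map (jet_rep r) v)"
    using assms by (auto simp: tuples_def jet_rep intro!: nth_equalityI dest: nth_mem)
qed (use assms in \<open>auto simp: tuples_def jet_rep\<close>)

lemma lift_form_in_forms: "lift_form r s G \<in> carrier (forms (jet_algebra r) s)"
proof -
  let ?A = "jet_algebra r :: (real, (real^'k \<Rightarrow> real) set) module" and ?F = "lift_form r s G"
  have jetE: thesis if "a \<in> carrier ?A" "\<And>f. smooth f \<Longrightarrow> a = jet r f \<Longrightarrow> thesis" for a thesis
    using that by (auto simp: carrier_jet_algebra)
  have slot: "?F ((map (jet r) fs)[t := jet r f]) (jet r h) = G (fs[t := f]) h"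
    if "length fs = s" "set fs \<subseteq> Collect smooth" "smooth f" "smooth h" for fs t f h
    using lift_form_jet[of "fs[t := f]" h] that set_list_update_smooth[of fs f t] by (simp add: map_update)
  have dual: "?F v \<in> dual ?A" if v: "v \<in> tuples ?A s" for v
  proof -
    from v obtain fs where fs: "v = map (jet r) fs" "length fs = s" "set fs \<subseteq> Collect smooth"
      by (rule tuples_jetE)
    show ?thesis
      unfolding dual_def
    proof (clarify, intro conjI ballI allI impI)
      fix a assume "a \<notin> carrier ?A"
      then show "?F v a = 0" by (simp add: lift_form_def)
    next
      fix a b assume "a \<in> carrier ?A" "b \<in> carrier ?A"
      then show "?F v (a \<oplus>\<^bsub>?A\<^esub> b) = ?F v a + ?F v b"
        by (elim jetE) (simp add: fs jet_add lift_form_jet add smooth_add)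
    next
      fix a c assume "a \<in> carrier ?A"
      then show "?F v (c \<odot>\<^bsub>?A\<^esub> a) = c * ?F v a"
        by (elim jetE) (simp add: fs jet_smult lift_form_jet scale smooth_cmult)
    qed
  qed
  have "?F \<in> multilinear_maps ?A s"
    unfolding multilinear_maps_def
  proof (clarify, intro conjI ballI allI impI)
    fix v t a b d assume "v \<in> tuples ?A s" "t < s" "a \<in> carrier ?A" "b \<in> carrier ?A" "d \<in> carrier ?A"
    then show "?F (v[t := a \<oplus>\<^bsub>?A\<^esub> b]) d = ?F (v[t := a]) d + ?F (v[t := b]) d"
      by (elim jetE tuples_jetE) (simp add: jet_add slot slot_add smooth_add)
  next
    fix v t a c d assume "v \<in> tuples ?A s" "t < s" "a \<in> carrier ?A" "d \<in> carrier ?A"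
    then show "?F (v[t := c \<odot>\<^bsub>?A\<^esub> a]) d = c * ?F (v[t := a]) d"
      by (elim jetE tuples_jetE) (simp add: jet_smult slot slot_scale smooth_cmult)
  qed (auto simp: dual lift_form_def)
  moreover have "skew_symmetric ?A s ?F"
    unfolding skew_symmetric_def
  proof (intro conjI ballI allI impI)
    fix v p q d assume "v \<in> tuples ?A s" and pq: "p < s" "q < s" "p \<noteq> q" and "d \<in> carrier ?A"
    then obtain fs f where fs: "v = map (jet r) fs" "length fs = s" "set fs \<subseteq> Collect smooth"
      and f: "smooth f" "d = jet r f" by (auto elim!: jetE tuples_jetE)
    have "v[p := v ! q, q := v ! p] = map (jet r) (fs[p := fs ! q, q := fs ! p])"
      using pq fs by (simp add: map_update)
    moreover have "set (fs[p := fs ! q, q := fs ! p]) \<subseteq> Collect smooth"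
      using pq fs by (intro set_list_update_smooth) (auto dest!: nth_mem[of _ fs])
    ultimately show "?F (v[p := v ! q, q := v ! p]) d = - ?F v d"
      using pq fs f skew[of fs p q f] by (simp add: lift_form_jet)
  qed
  moreover have "derivation_like ?A s ?F"
    unfolding derivation_like_def
  proof (intro conjI ballI allI impI)
    fix v t a b d assume "v \<in> tuples ?A s" "t < s" "a \<in> carrier ?A" "b \<in> carrier ?A" "d \<in> carrier ?A"
    then show "?F (v[t := a \<otimes>\<^bsub>?A\<^esub> b]) d =
        ?F (v[t := a]) (b \<otimes>\<^bsub>?A\<^esub> d) + ?F (v[t := b]) (a \<otimes>\<^bsub>?A\<^esub> d)"
      by (elim jetE tuples_jetE) (simp add: jet_mult slot leibniz smooth_mult)
  qed
  ultimately show ?thesis by (simp add: forms_def)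
qed

end


section \<open>A form is determined by its coordinates\<close>

definition coord :: "'k::finite \<Rightarrow> real^'k \<Rightarrow> real"
  where "coord i u = u $ i"

lemma smooth_coord_fun: "smooth (coord i)"
  unfolding coord_def[abs_def] by (rule smooth_coord)

context smooth_form
begin

lemma zero_arg: "length fs = s \<Longrightarrow> set fs \<subseteq> Collect smooth \<Longrightarrow> G fs (\<lambda>u. 0) = 0"
  using scale[of fs "\<lambda>u. 0" 0] by (simp add: smooth_const)

lemma slot_zero:
  "length fs = s \<Longrightarrow> set fs \<subseteq> Collect smooth \<Longrightarrow> t < s \<Longrightarrow> smooth h \<Longrightarrow> G (fs[t := \<lambda>u. 0]) h = 0"
  using slot_scale[of fs t "\<lambda>u. 0" h 0] by (simp add: smooth_const)

lemma slot_jet_cong: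
  assumes "length fs = s" "set fs \<subseteq> Collect smooth" "smooth h" "smooth f" "smooth g" "jet r f = jet r g"
  shows "G (fs[t := f]) h = G (fs[t := g]) h"
  using assms by (intro jet_cong set_list_update_smooth) (auto simp: map_update)

text \<open>Only the jet of \<open>f\<close> matters, so \<open>f\<close> may be replaced by its
  Taylor polynomial; linearity does the rest.\<close>

lemma vanish_if_vanish_on_monomials:
  assumes fs: "length fs = s" "set fs \<subseteq> Collect smooth" and f: "smooth f"
    and zero: "\<And>\<alpha>. sum \<alpha> UNIV \<le> r \<Longrightarrow> G fs (monomial \<alpha>) = 0"
  shows "G fs f = 0"
proof -
  have "G fs (\<lambda>u. \<Sum>\<alpha>\<in>S. taylor_coeff \<alpha> f * monomial \<alpha> u) = 0"
    if "finite S" "S \<subseteq> {\<alpha>. sum \<alpha> UNIV \<le> r}" for S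
    using that
    by (induction S rule: finite_induct)
      (simp_all add: fs zero zero_arg add scale smooth_cmult smooth_monomial smooth_sum)
  from this[OF finite_multi_indices subset_refl] fs f show ?thesis
    by (subst jet_cong[OF _ _ _ _ _ refl jet_taylor])
      (auto intro!: smooth_sum smooth_cmult smooth_monomial)
qed

lemma slot_vanish_if_vanish_on_monomials:
  assumes fs: "length fs = s" "set fs \<subseteq> Collect smooth" "t < s" and f: "smooth f" and h: "smooth h"
    and zero: "\<And>\<alpha>. G (fs[t := monomial \<alpha>]) h = 0"
  shows "G (fs[t := f]) h = 0"
proof -
  have "G (fs[t := \<lambda>u. \<Sum>\<alpha>\<in>S. taylor_coeff \<alpha> f * monomial \<alpha> u]) h = 0" if "finite S" for S
    using that
    by (induction S rule: finite_induct)
      (simp_all add: fs h zero slot_zero slot_add slot_scale smooth_cmult smooth_monomial smooth_sum)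
  from this[OF finite_multi_indices] fs f h show ?thesis
    by (subst slot_jet_cong[OF _ _ _ _ _ jet_taylor])
      (auto intro!: smooth_sum smooth_cmult smooth_monomial)
qed

text \<open>The derivation rule for \<open>1 = 1 * 1\<close> says that the value equals twice
  itself.\<close>

lemma slot_one:
  assumes "length fs = s" "set fs \<subseteq> Collect smooth" "t < s" "smooth h"
  shows "G (fs[t := \<lambda>u. 1]) h = 0"
proof -
  have "G (fs[t := \<lambda>u. 1 * 1]) h = G (fs[t := \<lambda>u. 1]) (\<lambda>u. 1 * h u) + G (fs[t := \<lambda>u. 1]) (\<lambda>u. 1 * h u)"
    by (rule leibniz[OF assms(1-3) smooth_const smooth_const assms(4)])
  then show ?thesis by simp
qed

text \<open>The formula for the differential of a monomial, with coefficients moved into the last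
  argument. The induction on the degree splits off one variable \<open>p\<close>.\<close>

lemma slot_monomial:
  assumes fs: "length fs = s" "set fs \<subseteq> Collect smooth" "t < s" and "smooth h"
  shows "G (fs[t := monomial \<alpha>]) h =
    (\<Sum>l\<in>UNIV. real (\<alpha> l) * G (fs[t := coord l]) (\<lambda>u. monomial (\<alpha>(l := \<alpha> l - 1)) u * h u))"
  using \<open>smooth h\<close>
proof (induction "sum \<alpha> UNIV" arbitrary: \<alpha> h)
  case 0
  then have "\<alpha> = (\<lambda>_. 0)" by auto
  with 0 show ?case by (simp add: monomial_0 slot_one fs)
next
  case (Suc n)
  then obtain p where p: "\<alpha> p > 0"
    by (metis gr0I sum.neutral zero_less_Suc less_irrefl)
  define \<beta> where "\<beta> = \<alpha>(p := \<alpha> p - 1)"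
  have \<alpha>: "\<alpha> = \<beta>(p := Suc (\<beta> p))" using p by (auto simp: \<beta>_def)
  have "sum \<alpha> UNIV = Suc (sum \<beta> UNIV)"
    unfolding \<alpha> by (subst (1 2) sum.remove[of _ p]) auto
  with Suc have n: "n = sum \<beta> UNIV" by simp
  \<comment> \<open>For \<open>l \<noteq> p\<close> the split-off variable is just absorbed into the
    monomial. For \<open>l = p\<close> the extra term raises the coefficient from
    \<open>\<beta> p\<close> to \<open>\<alpha> p\<close>.\<close>
  have summand: "real (\<beta> l) * G (fs[t := coord l]) (\<lambda>u. monomial (\<beta>(l := \<beta> l - 1)) u * (coord p u * h u)) +
      (if l = p then G (fs[t := coord p]) (\<lambda>u. monomial \<beta> u * h u) else 0) =
      real (\<alpha> l) * G (fs[t := coord l]) (\<lambda>u. monomial (\<alpha>(l := \<alpha> l - 1)) u * h u)" for l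
  proof (cases "l = p")
    case False
    then have "\<alpha>(l := \<alpha> l - 1) = (\<beta>(l := \<beta> l - 1))(p := Suc ((\<beta>(l := \<beta> l - 1)) p))"
      by (auto simp: \<alpha>)
    then have "monomial (\<alpha>(l := \<alpha> l - 1)) u = coord p u * monomial (\<beta>(l := \<beta> l - 1)) u" for u
      by (simp only: monomial_upd_Suc coord_def)
    moreover have "\<alpha> l = \<beta> l" using False by (simp add: \<alpha>)
    ultimately show ?thesis using False by (simp add: mult_ac)
  next
    case True
    \<comment> \<open>When \<open>\<beta> p = 0\<close> this identity fails, but both sides of the
      next one are then multiplied by 0.\<close>
    have "monomial \<beta> u = coord p u * monomial (\<beta>(p := \<beta> p - 1)) u" if "\<beta> p > 0" for u
      using monomial_upd_Suc[of "\<beta>(p := \<beta> p - 1)" p u] that by (simp add: coord_def)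
    then have "real (\<beta> p) * G (fs[t := coord p]) (\<lambda>u. monomial (\<beta>(p := \<beta> p - 1)) u * (coord p u * h u)) =
        real (\<beta> p) * G (fs[t := coord p]) (\<lambda>u. monomial \<beta> u * h u)"
      by (cases "\<beta> p > 0") (simp_all add: mult_ac)
    moreover have "\<alpha>(p := \<alpha> p - 1) = \<beta>" "\<alpha> p = Suc (\<beta> p)" by (simp_all add: \<alpha>)
    ultimately show ?thesis
      using True by (simp add: distrib_right)
  qed
  have "monomial \<alpha> = (\<lambda>u. coord p u * monomial \<beta> u)"
    unfolding \<alpha> by (simp add: monomial_upd_Suc coord_def fun_eq_iff)
  then have "G (fs[t := monomial \<alpha>]) h = G (fs[t := coord p]) (\<lambda>u. monomial \<beta> u * h u) +
      G (fs[t := monomial \<beta>]) (\<lambda>u. coord p u * h u)"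
    using leibniz[OF fs smooth_coord_fun smooth_monomial Suc.prems] by simp
  also have "\<dots> = (\<Sum>l\<in>UNIV. real (\<beta> l) *
        G (fs[t := coord l]) (\<lambda>u. monomial (\<beta>(l := \<beta> l - 1)) u * (coord p u * h u)) +
      (if l = p then G (fs[t := coord p]) (\<lambda>u. monomial \<beta> u * h u) else 0))"
    using Suc.hyps(1)[OF n, of "\<lambda>u. coord p u * h u"] Suc.prems
    by (simp add: smooth_mult smooth_coord_fun sum.distrib)
  also have "\<dots> = (\<Sum>l\<in>UNIV. real (\<alpha> l) *
      G (fs[t := coord l]) (\<lambda>u. monomial (\<alpha>(l := \<alpha> l - 1)) u * h u))"
    by (simp only: summand)
  finally show ?case .
qed

text \<open>The slots are turned into coordinates from the last to the first; \<open>n\<close>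
  counts those still arbitrary. Each replacement changes the last argument, so the hypothesis must
  cover every smooth \<open>h\<close>.\<close>

lemma vanish_if_vanish_on_coords:
  assumes zero: "\<And>I h. length I = s \<Longrightarrow> smooth h \<Longrightarrow> G (map coord I) h = 0"
    and "length fs = s" "set fs \<subseteq> Collect smooth" "smooth h"
  shows "G fs h = 0"
proof -
  have "G fs h = 0" if "n \<le> s" "length fs = s" "set fs \<subseteq> Collect smooth" "smooth h"
    "\<And>t. n \<le> t \<Longrightarrow> t < s \<Longrightarrow> fs ! t \<in> range coord" for n fs h
    using that
  proof (induction n arbitrary: fs h)
    case 0
    then have "set fs \<subseteq> range coord" by (auto simp: in_set_conv_nth)
    then obtain I where "fs = map coord I"
      by (metis ex_map_conv image_iff subset_eq)
    with 0 zero show ?case by auto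
  next
    case (Suc n)
    \<comment> \<open>With a coordinate in slot \<open>n\<close>, all slots from \<open>n\<close> on
      are coordinates and the induction hypothesis applies.\<close>
    have "G (fs[n := coord i]) g = 0" if "smooth g" for i g
      using Suc.prems that
      by (intro Suc.IH set_list_update_smooth smooth_coord_fun) (auto simp: nth_list_update)
    then have "G (fs[n := monomial \<alpha>]) h = 0" for \<alpha>
      using Suc.prems by (subst slot_monomial) (auto simp: smooth_mult smooth_monomial)
    moreover have "n < s" using Suc.prems by simp
    moreover from this have "smooth (fs ! n)"
      using Suc.prems(2,3) nth_mem[of n fs] by blast
    ultimately have "G (fs[n := fs ! n]) h = 0"
      using Suc.prems(2-4) by (metis slot_vanish_if_vanish_on_monomials)
    then show ?case by simp
  qed
  from this[of s] show ?thesis using assms(2-4) by simp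
qed

section \<open>Reordering coordinate arguments\<close>

text \<open>Vanishing is insensitive to sign, so an induction over transpositions suffices without
  computing the sign of \<open>p\<close>.\<close>

lemma skew_permute:
  assumes "p permutes {..<s}" "length fs = s" "set fs \<subseteq> Collect smooth" "smooth h" "G fs h = 0"
  shows "G (permute_list p fs) h = 0"
  using finite_lessThan assms(1)
proof (induction p rule: permutes_rev_induct)
  case id
  with assms show ?case by simp
next
  case (swap a b p)
  let ?gs = "permute_list p fs"
  have gs: "length ?gs = s" "set ?gs \<subseteq> Collect smooth"
    using assms swap by simp_all
  have ab: "a < s" "b < s" using swap by auto
  have "permute_list (p \<circ> Transposition.transpose a b) fs = ?gs[a := ?gs ! b, b := ?gs ! a]"
    using ab assms(2) swap
    by (intro nth_equalityI) (auto simp: permute_list_def nth_list_update Transposition.transpose_def)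
  then show ?case
    using skew[OF gs ab \<open>a \<noteq> b\<close> assms(4)] swap by (simp add: comp_def)
qed

text \<open>If an index repeats, swapping the two equal arguments changes nothing, so the value
  equals its own negative. Hence the hypothesis is required for distinct \<open>I\<close>
  only.\<close>

lemma coords_vanish_if_permuted_vanish:
  assumes I: "length I = s" "smooth h" and J: "mset J = mset I"
    and zero: "distinct I \<Longrightarrow> G (map coord J) h = 0"
  shows "G (map coord I) h = 0"
proof (cases "distinct I")
  case True
  from J have "mset I = mset J" by simp
  then obtain p where p: "p permutes {..<length J}" "permute_list p J = I"
    by (rule mset_eq_permutation)
  have "length J = s" using J I(1) by (metis size_mset)
  with p zero[OF True] assms(2) have "G (permute_list p (map coord J)) h = 0"
    by (intro skew_permute) (auto simp: smooth_coord_fun)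
  with p show ?thesis by (simp add: permute_list_map)
next
  case False
  then obtain p q where pq: "p < s" "q < s" "p \<noteq> q" "I ! p = I ! q"
    using assms(1) by (auto simp: distinct_conv_nth)
  then have "(map coord I)[p := map coord I ! q, q := map coord I ! p] = map coord I"
    using assms(1) by (intro nth_equalityI) (auto simp: nth_list_update)
  then have "G (map coord I) h = - G (map coord I) h"
    using skew[of "map coord I" p q h] pq assms smooth_coord_fun by (auto simp: image_subset_iff)
  then show ?thesis by simp
qed

end


text \<open>The core of injectivity. The rewriting in \<open>sorted_case\<close> ends after one
  step: all other terms of the relation fall under \<open>below\<close>, so no induction on
  monomials arises.\<close>

lemma smooth_form_eq_0:
  fixes G :: "(real^'k::{finite,linorder} \<Rightarrow> real) list \<Rightarrow> (real^'k::{finite,linorder} \<Rightarrow> real) \<Rightarrow> real"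
  assumes G: "smooth_form r s G" and r: "r \<ge> 1" and s: "s \<ge> 1"
    and zero: "\<And>I \<alpha>. (I, \<alpha>) \<in> index_set r s \<Longrightarrow> G (map coord I) (monomial \<alpha>) = 0"
    and fs: "length fs = s" "set fs \<subseteq> Collect smooth" "smooth h"
  shows "G fs h = 0"
proof -
  interpret smooth_form r s G by (rule G)
  \<comment> \<open>The bound is put on all entries instead of the last one, because it is later
    applied to lists that need not be sorted.\<close>
  have below: "G (map coord I) (monomial \<alpha>) = 0"
    if I: "length I = s"
      and \<alpha>: "sum \<alpha> UNIV < r \<or> sum \<alpha> UNIV = r \<and> (\<forall>i\<in>set I. i < Max {l. \<alpha> l > 0})" for I \<alpha>
  proof (rule coords_vanish_if_permuted_vanish[OF I smooth_monomial mset_sort])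
    assume "distinct I"
    then have "sorted_wrt (<) (sort I)" by (simp add: strict_sorted_iff)
    moreover have "last (sort I) \<in> set I"
      using I s last_in_set[of "sort I"] by (metis length_sort list.size(3) not_one_le_zero set_sort)
    ultimately show "G (map coord (sort I)) (monomial \<alpha>) = 0"
      using I \<alpha> by (intro zero) (auto simp: index_set_def)
  qed
  have sorted_case: "G (map coord J) (monomial \<alpha>) = 0"
    if J: "length J = s" "sorted_wrt (<) J" and \<alpha>: "sum \<alpha> UNIV = r" and le: "Max {l. \<alpha> l > 0} \<le> last J" for J \<alpha>
  proof -
    let ?m = "last J" and ?fs = "map coord J"
    define \<gamma> where "\<gamma> = \<alpha>(?m := Suc (\<alpha> ?m))"
    have supp_le: "l \<le> ?m" if "\<alpha> l > 0" for l
      by (rule order_trans[OF Max_ge le]) (use that in auto)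
    have t: "s - 1 < s" using s by simp
    have m: "J ! (s - 1) = ?m" using J s by (cases J) (auto simp: last_conv_nth)
    have fs: "length ?fs = s" "set ?fs \<subseteq> Collect smooth" using J by (auto simp: smooth_coord_fun)
    have sum_\<gamma>: "sum \<gamma> UNIV = Suc r"
      unfolding \<gamma>_def \<alpha>[symmetric] by (subst (1 2) sum.remove[of _ ?m]) auto
    \<comment> \<open>Such an \<open>l\<close> is smaller than \<open>?m\<close>. Since
      \<open>\<gamma> ?m = Suc (\<alpha> ?m)\<close>, the variable \<open>?m\<close> still occurs
      after lowering at \<open>l\<close>, even if \<open>\<alpha> ?m = 0\<close>; replacing the last
      entry of \<open>J\<close> by \<open>l\<close> leaves only entries below
      \<open>?m\<close>.\<close>
    have other: "G (?fs[s - 1 := coord l]) (monomial (\<gamma>(l := \<gamma> l - 1))) = 0"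
      if l: "l \<noteq> ?m" "\<gamma> l > 0" for l
    proof -
      let ?\<delta> = "\<gamma>(l := \<gamma> l - 1)" and ?L = "J[s - 1 := l]"
      have "l < ?m" using supp_le[of l] l by (simp add: \<gamma>_def)
      have "Max {i. ?\<delta> i > 0} = ?m"
        using supp_le l by (intro Max_eqI) (auto simp: \<gamma>_def split: if_splits)
      moreover have "\<forall>i\<in>set ?L. i < ?m"
      proof
        fix i assume "i \<in> set ?L"
        then obtain j where j: "j < s" "i = ?L ! j" using J by (auto simp: in_set_conv_nth)
        show "i < ?m"
        proof (cases "j = s - 1")
          case True
          with j J \<open>l < ?m\<close> show ?thesis by simp
        next
          case False
          with j J have "i = J ! j" "j < s - 1" by auto
          with J show ?thesis unfolding m[symmetric] by (simp add: sorted_wrt_nth_less)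
        qed
      qed
      moreover have "sum ?\<delta> UNIV = r"
      proof -
        have "Suc (sum ?\<delta> UNIV) = sum \<gamma> UNIV"
          by (subst (1 2) sum.remove[of _ l]) (use l in auto)
        with sum_\<gamma> show ?thesis by simp
      qed
      ultimately have "G (map coord ?L) (monomial ?\<delta>) = 0"
        using J by (intro below) auto
      then show ?thesis by (simp add: map_update)
    qed
    \<comment> \<open>\<open>x\<^sup>\<gamma>\<close> has degree \<open>r + 1\<close>, so its jet is 0, and the derivation rule for it is a linear relation
      in which the value at \<open>(J, \<alpha>)\<close> is the only one whose indices do not all lie below
      the largest variable of the monomial.\<close>
    have "jet r (monomial \<gamma>) = jet r (\<lambda>u. 0)"
      by (rule jet_monomial_eq_0) (simp add: sum_\<gamma>)
    then have "0 = G (?fs[s - 1 := monomial \<gamma>]) (\<lambda>u. 1)"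
      by (subst slot_jet_cong[OF fs smooth_const smooth_monomial smooth_const])
        (use slot_zero[OF fs t smooth_const, of 1] in simp_all)
    also have "\<dots> = (\<Sum>l\<in>UNIV. real (\<gamma> l) *
        G (?fs[s - 1 := coord l]) (monomial (\<gamma>(l := \<gamma> l - 1))))"
      by (subst slot_monomial[OF fs t]) (simp_all add: smooth_const)
    also have "\<dots> = real (\<gamma> ?m) * G (?fs[s - 1 := coord ?m]) (monomial (\<gamma>(?m := \<gamma> ?m - 1)))"
    proof -
      have "real (\<gamma> l) * G (?fs[s - 1 := coord l]) (monomial (\<gamma>(l := \<gamma> l - 1))) = 0" if "l \<noteq> ?m" for l
        using other[OF that] by (cases "\<gamma> l > 0") auto
      then have "(\<Sum>l\<in>UNIV - {?m}. real (\<gamma> l) *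
          G (?fs[s - 1 := coord l]) (monomial (\<gamma>(l := \<gamma> l - 1)))) = 0"
        by (intro sum.neutral ballI) blast
      then show ?thesis
        by (subst sum.remove[of _ ?m]) simp_all
    qed
    also have "?fs[s - 1 := coord ?m] = ?fs"
      using m J t by (metis list_update_id map_update)
    also have "\<gamma>(?m := \<gamma> ?m - 1) = \<alpha>" by (simp add: \<gamma>_def)
    \<comment> \<open>The remaining coefficient \<open>real (Suc (\<alpha> ?m))\<close> is nonzero
      and can be cancelled.\<close>
    finally show ?thesis by (simp add: \<gamma>_def)
  qed
  have monomials: "G (map coord I) (monomial \<alpha>) = 0"
    if I: "length I = s" and \<alpha>: "sum \<alpha> UNIV \<le> r" for I \<alpha>
  proof (rule coords_vanish_if_permuted_vanish[OF I smooth_monomial mset_sort])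
    assume "distinct I"
    then have J: "sorted_wrt (<) (sort I)" by (simp add: strict_sorted_iff)
    consider "(sort I, \<alpha>) \<in> index_set r s" | "sum \<alpha> UNIV = r" "Max {l. \<alpha> l > 0} \<le> last (sort I)"
      using I \<alpha> J by (force simp: index_set_def)
    then show "G (map coord (sort I)) (monomial \<alpha>) = 0"
      using I J by cases (auto intro: zero sorted_case)
  qed
  have "G (map coord I) d = 0" if I: "length I = s" and d: "smooth d" for I d
  proof (rule vanish_if_vanish_on_monomials[OF _ _ d monomials[OF I]])
    show "set (map coord I) \<subseteq> Collect smooth" by (auto simp: smooth_coord_fun)
  qed (simp_all add: I)
  then show ?thesis
    using fs by (rule vanish_if_vanish_on_coords)
qed


section \<open>Jacobian determinants\<close>

lemma jet_mono_order: "n \<le> r \<Longrightarrow> smooth f \<Longrightarrow> smooth g \<Longrightarrow> jet r f = jet r g \<Longrightarrow> jet n f = jet n g"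
  by (simp add: jet_eq_iff)

text \<open>A derivative costs one order, whence \<open>n < r\<close>. This loss is why the forms
  built below only read coefficients of degree less than \<open>r\<close>.\<close>

lemma jet_partial_deriv_cong:
  assumes "n < r" "smooth f" "smooth g" "jet r f = jet r g"
  shows "jet n (partial_deriv i f) = jet n (partial_deriv i g)"
proof (subst jet_eq_iff[OF smoothD(2)[OF assms(2)] smoothD(2)[OF assms(3)]], intro allI impI)
  fix xs :: "'a list" assume "length xs \<le> n"
  with assms show "iter_partial xs (partial_deriv i f) 0 = iter_partial xs (partial_deriv i g) 0"
    using jet_eq_iff[of f g r] by (auto dest: spec[of _ "i # xs"])
qed

lemma jet_mult_cong:
  assumes "smooth f" "smooth f'" "smooth g" "smooth g'" "jet n f = jet n f'" "jet n g = jet n g'"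
  shows "jet n (\<lambda>u. f u * g u) = jet n (\<lambda>u. f' u * g' u)"
  using assms jet_mult[of f g n] jet_mult[of f' g' n] by simp

lemma jet_add_cong:
  assumes "smooth f" "smooth f'" "smooth g" "smooth g'" "jet n f = jet n f'" "jet n g = jet n g'"
  shows "jet n (\<lambda>u. f u + g u) = jet n (\<lambda>u. f' u + g' u)"
  using assms jet_add[of f g n] jet_add[of f' g' n] by simp

lemma jet_sum_cong:
  assumes "\<And>x. x \<in> S \<Longrightarrow> smooth (f x)" "\<And>x. x \<in> S \<Longrightarrow> smooth (g x)"
    and "\<And>x. x \<in> S \<Longrightarrow> jet n (f x) = jet n (g x)"
  shows "jet n (\<lambda>u. \<Sum>x\<in>S. f x u) = jet n (\<lambda>u. \<Sum>x\<in>S. g x u)"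
  using assms
proof (induction S rule: infinite_finite_induct)
  case (insert x S)
  then have "jet n (\<lambda>u. f x u + (\<Sum>x\<in>S. f x u)) = jet n (\<lambda>u. g x u + (\<Sum>x\<in>S. g x u))"
    by (intro jet_add_cong smooth_sum) simp_all
  with insert show ?case by simp
qed simp_all

lemma jet_prod_cong:
  assumes "\<And>x. x \<in> S \<Longrightarrow> smooth (f x)" "\<And>x. x \<in> S \<Longrightarrow> smooth (g x)"
    and "\<And>x. x \<in> S \<Longrightarrow> jet n (f x) = jet n (g x)"
  shows "jet n (\<lambda>u. \<Prod>x\<in>S. f x u) = jet n (\<lambda>u. \<Prod>x\<in>S. g x u)"
  using assms
proof (induction S rule: infinite_finite_induct)
  case (insert x S)
  then have "jet n (\<lambda>u. f x u * (\<Prod>x\<in>S. f x u)) = jet n (\<lambda>u. g x u * (\<Prod>x\<in>S. g x u))"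
    by (intro jet_mult_cong smooth_prod) simp_all
  with insert show ?case by simp
qed simp_all

lemma taylor_coeff_jet_cong:
  assumes "smooth f" "smooth g" "jet n f = jet n g" "sum \<beta> UNIV \<le> n"
  shows "taylor_coeff \<beta> f = taylor_coeff \<beta> g"
  using assms by (simp add: taylor_coeff_def jet_eq_iff length_eq_sum_count_list count_list_multi_word)

text \<open>The minor of the Jacobian matrix of \<open>fs\<close> with columns \<open>I\<close>. For
  increasing \<open>I\<close> it is the coefficient of \<open>dx^I\<close> in the wedge product of
  the differentials of \<open>fs\<close>.\<close>

definition jacobian :: "'k::finite list \<Rightarrow> (real^'k \<Rightarrow> real) list \<Rightarrow> real^'k \<Rightarrow> real"
  where "jacobian I fs u = (\<Sum>\<sigma> | \<sigma> permutes {..<length I}.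
    of_int (sign \<sigma>) * (\<Prod>p<length I. partial_deriv (I ! \<sigma> p) (fs ! p) u))"

lemma smooth_nth: "set fs \<subseteq> Collect smooth \<Longrightarrow> p < length fs \<Longrightarrow> smooth (fs ! p)"
  using nth_mem by blast

lemma smooth_jacobian:
  assumes "length fs = length I" "set fs \<subseteq> Collect smooth"
  shows "smooth (jacobian I fs)"
proof -
  have "smooth (fs ! p)" if "p < length I" for p
    using assms that by (simp add: smooth_nth)
  then show ?thesis
    unfolding jacobian_def[abs_def] by (intro smooth_sum smooth_cmult smooth_prod smoothD) auto
qed

text \<open>Expanding with slot \<open>t\<close> isolated reduces the sum, scalar and product rules
  in that slot to those of \<open>partial_deriv\<close>.\<close>

lemma jacobian_update:
  assumes "length fs = length I" "t < length I"
  shows "jacobian I (fs[t := f]) u = (\<Sum>\<sigma> | \<sigma> permutes {..<length I}.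
    of_int (sign \<sigma>) * (\<Prod>p\<in>{..<length I} - {t}. partial_deriv (I ! \<sigma> p) (fs ! p) u) *
      partial_deriv (I ! \<sigma> t) f u)"
  unfolding jacobian_def
proof (intro sum.cong refl)
  fix \<sigma>
  show "of_int (sign \<sigma>) * (\<Prod>p<length I. partial_deriv (I ! \<sigma> p) (fs[t := f] ! p) u) =
    of_int (sign \<sigma>) * (\<Prod>p\<in>{..<length I} - {t}. partial_deriv (I ! \<sigma> p) (fs ! p) u) *
      partial_deriv (I ! \<sigma> t) f u"
    using assms by (subst prod.remove[of _ t]) auto
qed

lemma jacobian_add:
  assumes "length fs = length I" "t < length I" "smooth f" "smooth g"
  shows "jacobian I (fs[t := \<lambda>u. f u + g u]) u = jacobian I (fs[t := f]) u + jacobian I (fs[t := g]) u"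
  using assms
  by (simp add: jacobian_update partial_deriv_add smoothD distrib_left sum.distrib)

lemma jacobian_cmult:
  assumes "length fs = length I" "t < length I" "smooth f"
  shows "jacobian I (fs[t := \<lambda>u. c * f u]) u = c * jacobian I (fs[t := f]) u"
  using assms
  by (simp add: jacobian_update partial_deriv_cmult smoothD sum_distrib_left mult_ac)

lemma jacobian_mult:
  assumes "length fs = length I" "t < length I" "smooth f" "smooth g"
  shows "jacobian I (fs[t := \<lambda>u. f u * g u]) u =
    f u * jacobian I (fs[t := g]) u + g u * jacobian I (fs[t := f]) u"
  using assms
  by (simp add: jacobian_update partial_deriv_mult smoothD distrib_left sum.distrib
      sum_distrib_left mult_ac)

text \<open>Composing \<open>\<sigma>\<close> with the transposition reindexes the sum over
  permutations: the sign flips, while each product only has its factors permuted.\<close>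

lemma jacobian_swap:
  assumes "length fs = length I" "p < length I" "q < length I" "p \<noteq> q"
  shows "jacobian I (fs[p := fs ! q, q := fs ! p]) u = - jacobian I fs u"
proof -
  let ?n = "length I" and ?\<tau> = "Transposition.transpose p q"
  have \<tau>: "?\<tau> permutes {..<?n}" using assms by (intro permutes_swap_id) auto
  have nth: "fs[p := fs ! q, q := fs ! p] ! j = fs ! ?\<tau> j" if "j < ?n" for j
    using assms that by (auto simp: nth_list_update Transposition.transpose_def)
  have "jacobian I (fs[p := fs ! q, q := fs ! p]) u = (\<Sum>\<sigma> | \<sigma> permutes {..<?n}.
      of_int (sign \<sigma>) * (\<Prod>j<?n. partial_deriv (I ! \<sigma> j) (fs ! ?\<tau> j) u))"
    unfolding jacobian_def by (intro sum.cong arg_cong2[of _ _ _ _ "(*)"] prod.cong) (auto simp: nth)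
  also have "\<dots> = (\<Sum>\<sigma> | \<sigma> permutes {..<?n}.
      of_int (sign (\<sigma> \<circ> ?\<tau>)) * (\<Prod>j<?n. partial_deriv (I ! (\<sigma> \<circ> ?\<tau>) j) (fs ! ?\<tau> j) u))"
    by (rule sum_permutations_compose_right[OF \<tau>])
  also have "\<dots> = (\<Sum>\<sigma> | \<sigma> permutes {..<?n}.
      - (of_int (sign \<sigma>) * (\<Prod>j<?n. partial_deriv (I ! \<sigma> j) (fs ! j) u)))"
  proof (intro sum.cong refl)
    fix \<sigma> assume "\<sigma> \<in> {\<sigma>. \<sigma> permutes {..<?n}}"
    then have "sign (\<sigma> \<circ> ?\<tau>) = - sign \<sigma>"
      using assms(4)
      by (simp add: sign_compose permutation_swap_id sign_swap_id permutes_imp_permutation[of "{..<?n}"])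
    moreover have "(\<Prod>j<?n. partial_deriv (I ! \<sigma> j) (fs ! j) u) =
        (\<Prod>j<?n. partial_deriv (I ! (\<sigma> \<circ> ?\<tau>) j) (fs ! ?\<tau> j) u)"
      using prod.permute[OF \<tau>, of "\<lambda>j. partial_deriv (I ! \<sigma> j) (fs ! j) u"] by (simp add: comp_def)
    ultimately show "of_int (sign (\<sigma> \<circ> ?\<tau>)) *
        (\<Prod>j<?n. partial_deriv (I ! (\<sigma> \<circ> ?\<tau>) j) (fs ! ?\<tau> j) u) =
        - (of_int (sign \<sigma>) * (\<Prod>j<?n. partial_deriv (I ! \<sigma> j) (fs ! j) u))"
      by simp
  qed
  also have "\<dots> = - jacobian I fs u"
    unfolding jacobian_def by (rule sum_negf)
  finally show ?thesis .
qed

lemma jet_jacobian_cong: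
  assumes "n < r" "length fs = length I" "set fs \<subseteq> Collect smooth" "set gs \<subseteq> Collect smooth"
    and "map (jet r) fs = map (jet r) gs"
  shows "jet n (jacobian I fs) = jet n (jacobian I gs)"
proof -
  have len: "length gs = length I" using assms by (metis length_map)
  have fg: "smooth (fs ! p)" "smooth (gs ! p)" "jet r (fs ! p) = jet r (gs ! p)" if "p < length I" for p
    using assms len that nth_map[of p fs "jet r"] nth_map[of p gs "jet r"]
    by (auto simp: smooth_nth)
  have "jet n (\<lambda>u. \<Prod>p<length I. partial_deriv (I ! \<sigma> p) (fs ! p) u) =
      jet n (\<lambda>u. \<Prod>p<length I. partial_deriv (I ! \<sigma> p) (gs ! p) u)" for \<sigma>
    using assms(1) fg by (intro jet_prod_cong jet_partial_deriv_cong smoothD) auto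
  then show ?thesis
    unfolding jacobian_def[abs_def] using fg
    by (intro jet_sum_cong jet_mult_cong smooth_cmult smooth_const smooth_prod smoothD) auto
qed

lemma permute_list_eq_self_iff:
  assumes "\<sigma> permutes {..<length I}" "distinct I"
  shows "permute_list \<sigma> I = I \<longleftrightarrow> \<sigma> = id"
proof
  assume eq: "permute_list \<sigma> I = I"
  show "\<sigma> = id"
  proof
    fix p show "\<sigma> p = id p"
    proof (cases "p < length I")
      case True
      then have "I ! \<sigma> p = I ! p" using eq permute_list_nth[OF assms(1)] by metis
      moreover have "\<sigma> p < length I" using permutes_in_image[OF assms(1), of p] True by simp
      ultimately show ?thesis using True assms(2) by (simp add: nth_eq_iff_index_eq)
    next
      case False
      then show ?thesis using permutes_not_in[OF assms(1), of p] by simp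
    qed
  qed
qed simp

text \<open>An increasing list is determined by its set of entries, and a list without repetitions
  is fixed by the identity alone.\<close>

lemma permute_list_eq_sorted_iff:
  fixes I J :: "'a::linorder list"
  assumes "sorted_wrt (<) I" "sorted_wrt (<) J" "\<sigma> permutes {..<length I}"
  shows "permute_list \<sigma> I = J \<longleftrightarrow> \<sigma> = id \<and> I = J"
proof -
  have "I = J" if "permute_list \<sigma> I = J"
    using strict_sorted_equal[OF assms(2,1)] set_permute_list[OF assms(3)] that by simp
  then show ?thesis
    using permute_list_eq_self_iff[OF assms(3)] assms(1) by (auto simp: strict_sorted_iff)
qed

lemma prod_indicator: "finite S \<Longrightarrow> (\<Prod>p\<in>S. if P p then 1 else (0::real)) = (if \<forall>p\<in>S. P p then 1 else 0)"
  by (induction S rule: finite_induct) auto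

text \<open>The summand of \<open>\<sigma>\<close> is nonzero only if \<open>\<sigma>\<close>
  carries \<open>I\<close> to \<open>J\<close>; for increasing lists this leaves the
  identity.\<close>

lemma jacobian_coords:
  fixes I J :: "'k::{finite,linorder} list"
  assumes "length I = length J" "sorted_wrt (<) I" "sorted_wrt (<) J"
  shows "jacobian I (map coord J) u = (if I = J then 1 else 0)"
proof -
  have prod: "(\<Prod>p<length I. partial_deriv (I ! \<sigma> p) (map coord J ! p) u) = (if \<sigma> = id \<and> I = J then 1 else 0)"
    if \<sigma>: "\<sigma> permutes {..<length I}" for \<sigma>
  proof -
    have "(\<Prod>p<length I. partial_deriv (I ! \<sigma> p) (map coord J ! p) u) =
        (\<Prod>p<length I. if I ! \<sigma> p = J ! p then 1 else 0)"
      using assms(1) by (intro prod.cong) (auto simp: coord_def[abs_def] partial_deriv_coord)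
    also have "\<dots> = (if permute_list \<sigma> I = J then 1 else 0)"
      using assms(1) \<sigma> by (auto simp: prod_indicator list_eq_iff_nth_eq permute_list_nth)
    finally show ?thesis
      by (simp only: permute_list_eq_sorted_iff[OF assms(2,3) \<sigma>])
  qed
  have "jacobian I (map coord J) u =
      (\<Sum>\<sigma> | \<sigma> permutes {..<length I}. if \<sigma> = id then if I = J then 1 else 0 else 0)"
    unfolding jacobian_def by (intro sum.cong) (auto simp: prod)
  also have "\<dots> = (if I = J then 1 else 0)"
    by (subst sum.delta) (auto simp: finite_permutations permutes_id)
  finally show ?thesis .
qed

section \<open>Forms obtained from Taylor coefficients of Jacobians\<close>

lemma smooth_form_cmult:
  assumes "smooth_form r s G"
  shows "smooth_form r s (\<lambda>fs f. c * G fs f)"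
proof -
  interpret smooth_form r s G by (rule assms)
  show ?thesis
  proof
    show "c * G fs f = c * G gs g" if "length fs = s" "set fs \<subseteq> Collect smooth"
      "set gs \<subseteq> Collect smooth" "smooth f" "smooth g" "map (jet r) fs = map (jet r) gs"
      "jet r f = jet r g" for fs gs f g
      using jet_cong[OF that] by simp
  qed (simp_all add: add scale slot_add slot_scale skew leibniz distrib_left)
qed

lemma smooth_form_sum:
  assumes "\<And>z. z \<in> Z \<Longrightarrow> smooth_form r s (E z)"
  shows "smooth_form r s (\<lambda>fs f. \<Sum>z\<in>Z. E z fs f)"
proof
  show "(\<Sum>z\<in>Z. E z fs f) = (\<Sum>z\<in>Z. E z gs g)" if "length fs = s" "set fs \<subseteq> Collect smooth"
    "set gs \<subseteq> Collect smooth" "smooth f" "smooth g" "map (jet r) fs = map (jet r) gs"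
    "jet r f = jet r g" for fs gs f g
    by (intro sum.cong refl smooth_form.jet_cong[OF assms] that)
qed (simp_all add: smooth_form.add[OF assms] smooth_form.scale[OF assms]
    smooth_form.slot_add[OF assms] smooth_form.slot_scale[OF assms] smooth_form.skew[OF assms]
    smooth_form.leibniz[OF assms] sum.distrib sum_distrib_left sum_negf)

text \<open>Since \<open>\<beta>\<close> has degree below \<open>r\<close>, the coefficient depends
  only on jets of the Jacobian of order less than \<open>r\<close>, which the \<open>r\<close>-jets
  of \<open>fs\<close> determine. The derivation rule is \<open>jacobian_mult\<close>.\<close>

lemma smooth_form_low:
  fixes I :: "'k::finite list"
  assumes I: "length I = s" and \<beta>: "sum \<beta> UNIV < r"
  shows "smooth_form r s (\<lambda>fs f. taylor_coeff \<beta> (\<lambda>u. f u * jacobian I fs u))"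
proof
  note smooth = smooth_mult smooth_jacobian set_list_update_smooth smooth_add smooth_cmult
  fix fs :: "(real^'k \<Rightarrow> real) list" and f g h :: "real^'k \<Rightarrow> real" and c :: real and t p q :: nat
  assume fs: "length fs = s" "set fs \<subseteq> Collect smooth" and f: "smooth f"
  note len = fs(1)[folded I]
  {
    fix gs
    assume gs: "set gs \<subseteq> Collect smooth" "smooth g" "map (jet r) fs = map (jet r) gs" "jet r f = jet r g"
    then have "length gs = length I" using fs I by (metis length_map)
    then show "taylor_coeff \<beta> (\<lambda>u. f u * jacobian I fs u) = taylor_coeff \<beta> (\<lambda>u. g u * jacobian I gs u)"
      using gs f fs(2) len \<beta> jet_mono_order[of "sum \<beta> UNIV" r f g]
      by (intro taylor_coeff_jet_cong[where n = "sum \<beta> UNIV"] jet_mult_cong jet_jacobian_cong smooth) auto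
  next
    assume "smooth g"
    then show "taylor_coeff \<beta> (\<lambda>u. (f u + g u) * jacobian I fs u) =
        taylor_coeff \<beta> (\<lambda>u. f u * jacobian I fs u) + taylor_coeff \<beta> (\<lambda>u. g u * jacobian I fs u)"
      using f fs len by (simp add: smooth taylor_coeff_add distrib_right)
  next
    show "taylor_coeff \<beta> (\<lambda>u. c * f u * jacobian I fs u) =
        c * taylor_coeff \<beta> (\<lambda>u. f u * jacobian I fs u)"
      using f fs len taylor_coeff_cmult[of "\<lambda>u. f u * jacobian I fs u"] by (simp add: smooth mult.assoc)
  next
    assume t: "t < s" and g: "smooth g" and h: "smooth h"
    show "taylor_coeff \<beta> (\<lambda>u. h u * jacobian I (fs[t := \<lambda>u. f u + g u]) u) =
        taylor_coeff \<beta> (\<lambda>u. h u * jacobian I (fs[t := f]) u) +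
        taylor_coeff \<beta> (\<lambda>u. h u * jacobian I (fs[t := g]) u)"
      using t f g h fs len I
      by (simp add: smooth jacobian_add distrib_left flip: taylor_coeff_add)
    have "taylor_coeff \<beta> (\<lambda>u. h u * jacobian I (fs[t := \<lambda>u. f u * g u]) u) =
        taylor_coeff \<beta> (\<lambda>u. g u * h u * jacobian I (fs[t := f]) u + f u * h u * jacobian I (fs[t := g]) u)"
      using t f g h fs len I by (simp add: jacobian_mult algebra_simps)
    also have "\<dots> = taylor_coeff \<beta> (\<lambda>u. g u * h u * jacobian I (fs[t := f]) u) +
        taylor_coeff \<beta> (\<lambda>u. f u * h u * jacobian I (fs[t := g]) u)"
      using t f g h fs len I by (intro taylor_coeff_add smooth) auto
    finally show "taylor_coeff \<beta> (\<lambda>u. h u * jacobian I (fs[t := \<lambda>u. f u * g u]) u) = \<dots>" .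
  next
    assume t: "t < s" and h: "smooth h"
    then show "taylor_coeff \<beta> (\<lambda>u. h u * jacobian I (fs[t := \<lambda>u. c * f u]) u) =
        c * taylor_coeff \<beta> (\<lambda>u. h u * jacobian I (fs[t := f]) u)"
      using f fs len I
      by (simp add: smooth jacobian_cmult mult.left_commute[of _ c] flip: taylor_coeff_cmult)
  next
    assume "p < s" "q < s" "p \<noteq> q"
    then show "taylor_coeff \<beta> (\<lambda>u. f u * jacobian I (fs[p := fs ! q, q := fs ! p]) u) =
        - taylor_coeff \<beta> (\<lambda>u. f u * jacobian I fs u)"
      using f fs len I taylor_coeff_cmult[of "\<lambda>u. f u * jacobian I fs u" \<beta> "-1"]
      by (simp add: smooth jacobian_swap)
  }
qed

text \<open>This reads a coefficient of the exterior derivative of \<open>f df_1 ... df_s\<close>.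
  The last argument becomes row 0, which accounts for the extra entry of \<open>K\<close>.\<close>

lemma smooth_form_top:
  fixes K :: "'k::finite list"
  assumes K: "length K = Suc s" and \<beta>: "sum \<beta> UNIV < r"
  shows "smooth_form r s (\<lambda>fs f. taylor_coeff \<beta> (jacobian K (f # fs)))"
proof
  note smooth = smooth_mult smooth_jacobian set_list_update_smooth smooth_add smooth_cmult
  fix fs :: "(real^'k \<Rightarrow> real) list" and f g h :: "real^'k \<Rightarrow> real" and c :: real and t p q :: nat
  assume fs: "length fs = s" "set fs \<subseteq> Collect smooth" and f: "smooth f"
  have J: "smooth (jacobian K (x # fs))" "smooth (jacobian K (x # fs[t := y]))"
    if "smooth x" "smooth y" for x y t
    using that fs K set_list_update_smooth[of fs y t] by (auto intro!: smooth_jacobian)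
  have head_add: "jacobian K ((\<lambda>u. x u + y u) # gs) u = jacobian K (x # gs) u + jacobian K (y # gs) u"
    and head_mult: "jacobian K ((\<lambda>u. x u * y u) # gs) u = x u * jacobian K (y # gs) u + y u * jacobian K (x # gs) u"
    if "smooth x" "smooth y" "length gs = s" for x y gs u
    using jacobian_add[of "x # gs" K 0 x y u] jacobian_mult[of "x # gs" K 0 x y u] that K by simp_all
  have head_cmult: "jacobian K ((\<lambda>u. c * x u) # gs) u = c * jacobian K (x # gs) u"
    if "smooth x" "length gs = s" for x c gs u
    using jacobian_cmult[of "x # gs" K 0 x c u] that K by simp
  have tail_add: "jacobian K (z # fs[t := \<lambda>u. x u + y u]) u = jacobian K (z # fs[t := x]) u + jacobian K (z # fs[t := y]) u"
    and tail_mult: "jacobian K (z # fs[t := \<lambda>u. x u * y u]) u = x u * jacobian K (z # fs[t := y]) u + y u * jacobian K (z # fs[t := x]) u"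
    if "smooth x" "smooth y" "t < s" for x y z u t
    using jacobian_add[of "z # fs" K "Suc t" x y u] jacobian_mult[of "z # fs" K "Suc t" x y u] that K fs
    by simp_all
  have tail_cmult: "jacobian K (z # fs[t := \<lambda>u. c * x u]) u = c * jacobian K (z # fs[t := x]) u"
    if "smooth x" "t < s" for x c z u t
    using jacobian_cmult[of "z # fs" K "Suc t" x c u] that K fs by simp
  have swap: "jacobian K (x # fs[t := y]) u = - jacobian K (y # fs[t := x]) u" if "t < s" for x y t u
    using jacobian_swap[of "y # fs[t := x]" K 0 "Suc t" u] that K fs by simp
  {
    fix gs
    assume gs: "set gs \<subseteq> Collect smooth" "smooth g" "map (jet r) fs = map (jet r) gs" "jet r f = jet r g"
    then have "length gs = s" using fs by (metis length_map)
    then show "taylor_coeff \<beta> (jacobian K (f # fs)) = taylor_coeff \<beta> (jacobian K (g # gs))"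
      using gs f fs K \<beta>
      by (intro taylor_coeff_jet_cong[where n = "sum \<beta> UNIV"] jet_jacobian_cong smooth_jacobian) auto
  next
    assume g: "smooth g"
    have "jacobian K ((\<lambda>u. f u + g u) # fs) = (\<lambda>u. jacobian K (f # fs) u + jacobian K (g # fs) u)"
      using f g fs by (intro ext head_add)
    then show "taylor_coeff \<beta> (jacobian K ((\<lambda>u. f u + g u) # fs)) =
        taylor_coeff \<beta> (jacobian K (f # fs)) + taylor_coeff \<beta> (jacobian K (g # fs))"
      using f g by (simp add: taylor_coeff_add J)
  next
    have "jacobian K ((\<lambda>u. c * f u) # fs) = (\<lambda>u. c * jacobian K (f # fs) u)"
      using f fs by (intro ext head_cmult)
    then show "taylor_coeff \<beta> (jacobian K ((\<lambda>u. c * f u) # fs)) = c * taylor_coeff \<beta> (jacobian K (f # fs))"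
      using f by (simp add: taylor_coeff_cmult J)
  next
    assume t: "t < s" and g: "smooth g" and h: "smooth h"
    have "jacobian K (h # fs[t := \<lambda>u. f u + g u]) =
        (\<lambda>u. jacobian K (h # fs[t := f]) u + jacobian K (h # fs[t := g]) u)"
      using f g t by (intro ext tail_add)
    then show "taylor_coeff \<beta> (jacobian K (h # fs[t := \<lambda>u. f u + g u])) =
        taylor_coeff \<beta> (jacobian K (h # fs[t := f])) + taylor_coeff \<beta> (jacobian K (h # fs[t := g]))"
      using f g h by (simp add: taylor_coeff_add J)
    \<comment> \<open>Expanding row 0 on the right produces two further terms with factor
      \<open>h\<close>, having \<open>f\<close> and \<open>g\<close> in row 0 and slot
      \<open>t\<close> in opposite orders; they cancel by \<open>swap\<close>.\<close>
    have "jacobian K (h # fs[t := \<lambda>u. f u * g u]) u =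
        jacobian K ((\<lambda>u. g u * h u) # fs[t := f]) u + jacobian K ((\<lambda>u. f u * h u) # fs[t := g]) u" for u
      using f g h t fs swap[OF t, of f g u] by (simp add: tail_mult head_mult)
    then have "jacobian K (h # fs[t := \<lambda>u. f u * g u]) =
        (\<lambda>u. jacobian K ((\<lambda>u. g u * h u) # fs[t := f]) u + jacobian K ((\<lambda>u. f u * h u) # fs[t := g]) u)"
      by (rule ext)
    then show "taylor_coeff \<beta> (jacobian K (h # fs[t := \<lambda>u. f u * g u])) =
        taylor_coeff \<beta> (jacobian K ((\<lambda>u. g u * h u) # fs[t := f])) +
        taylor_coeff \<beta> (jacobian K ((\<lambda>u. f u * h u) # fs[t := g]))"
      using f g h by (simp add: taylor_coeff_add J smooth_mult)
  next
    assume t: "t < s" and h: "smooth h"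
    have "jacobian K (h # fs[t := \<lambda>u. c * f u]) = (\<lambda>u. c * jacobian K (h # fs[t := f]) u)"
      using f t by (intro ext tail_cmult)
    then show "taylor_coeff \<beta> (jacobian K (h # fs[t := \<lambda>u. c * f u])) =
        c * taylor_coeff \<beta> (jacobian K (h # fs[t := f]))"
      using f h by (simp add: taylor_coeff_cmult J)
  next
    assume "p < s" "q < s" "p \<noteq> q"
    then have "jacobian K (f # fs[p := fs ! q, q := fs ! p]) = (\<lambda>u. - 1 * jacobian K (f # fs) u)"
      using jacobian_swap[of "f # fs" K "Suc p" "Suc q"] fs K by (intro ext) simp
    then show "taylor_coeff \<beta> (jacobian K (f # fs[p := fs ! q, q := fs ! p])) =
        - taylor_coeff \<beta> (jacobian K (f # fs))"
      using f by (simp only: taylor_coeff_cmult J)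
  }
qed


section \<open>The dual basis\<close>

text \<open>
  If \<open>|\<alpha>| = r\<close>, then \<open>f \<mapsto> taylor_coeff \<alpha> (f * jacobian I fs)\<close> does not descend to jets, because
  \<open>jacobian I fs\<close> is only determined by the jets of \<open>fs\<close> up to order \<open>r - 1\<close>. Functionals of
  \<open>df \<and> df\<^sub>1 \<and> \<dots> \<and> df\<^sub>s\<close> of order \<open>r - 1\<close> do, and they see enough of the part of degree \<open>r\<close>.
\<close>
definition dual_form :: "nat \<Rightarrow> 'k::{finite,linorder} list \<times> ('k::{finite,linorder} \<Rightarrow> nat) \<Rightarrow>
    (real^'k::{finite,linorder} \<Rightarrow> real) list \<Rightarrow> (real^'k::{finite,linorder} \<Rightarrow> real) \<Rightarrow> real"
  where "dual_form r = (\<lambda>(I, \<alpha>) fs f.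
    if sum \<alpha> UNIV < r then taylor_coeff \<alpha> (\<lambda>u. f u * jacobian I fs u)
    else let m = Max {l. \<alpha> l > 0} in
      1 / \<alpha> m * taylor_coeff (\<alpha>(m := \<alpha> m - 1)) (jacobian (m # I) (f # fs)))"

lemma sum_decr:
  fixes \<alpha> :: "'k::finite \<Rightarrow> nat"
  assumes "\<alpha> l > 0"
  shows "Suc (sum (\<alpha>(l := \<alpha> l - 1)) UNIV) = sum \<alpha> UNIV"
  by (subst (1 2) sum.remove[of _ l]) (use assms in auto)

text \<open>Positive degree makes the support nonempty, so \<open>Max\<close> is meaningful; this is
  how \<open>r \<ge> 1\<close> enters the dual basis.\<close>

lemma Max_support:
  fixes \<alpha> :: "'k::{finite,linorder} \<Rightarrow> nat"
  assumes "sum \<alpha> UNIV > 0"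
  shows "\<alpha> (Max {l. \<alpha> l > 0}) > 0"
proof -
  have "\<alpha> \<noteq> (\<lambda>_. 0)" using assms by auto
  then have "{l. \<alpha> l > 0} \<noteq> {}" by (auto simp: fun_eq_iff)
  from Max_in[OF _ this] show ?thesis by simp
qed

lemma le_Max_support: "\<alpha> l > (0::nat) \<Longrightarrow> (l::'k::{finite,linorder}) \<le> Max {l. \<alpha> l > 0}"
  by (rule Max_ge) simp_all

lemma smooth_form_dual_form:
  assumes z: "z \<in> index_set r s" and r: "r \<ge> 1"
  shows "smooth_form r s (dual_form r z)"
proof -
  obtain I \<alpha> where I: "z = (I, \<alpha>)" by (cases z)
  from z have len: "length I = s" by (simp add: I index_set_def)
  show ?thesis
  proof (cases "sum \<alpha> UNIV < r")
    case True
    then show ?thesis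
      using smooth_form_low[OF len True] by (simp add: I dual_form_def)
  next
    case False
    with z have sum: "sum \<alpha> UNIV = r" by (simp add: I index_set_def)
    let ?m = "Max {l. \<alpha> l > 0}"
    have "sum (\<alpha>(?m := \<alpha> ?m - 1)) UNIV < r"
      using sum_decr[of \<alpha> ?m] Max_support[of \<alpha>] sum r by simp
    then show ?thesis
      using smooth_form_cmult[OF smooth_form_top[of "?m # I" s "\<alpha>(?m := \<alpha> ?m - 1)" r], of "1 / \<alpha> ?m"] False len
      by (simp add: I dual_form_def Let_def)
  qed
qed

lemma sorted_le_last:
  "sorted_wrt (<) (I :: 'a::linorder list) \<Longrightarrow> i \<in> set I \<Longrightarrow> i \<le> last I"
  by (induction I) (auto intro: less_imp_le)

text \<open>The differential of \<open>x^\<beta>\<close> wedged with \<open>dx^J\<close> is the sum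
  over \<open>l\<close> of \<open>\<beta> l\<close> times
  \<open>x^(\<beta> - e_l) dx^l dx^J\<close>. Matching it with
  \<open>x^(\<alpha> - e_m) dx^m dx^I\<close> at \<open>l = m\<close> forces \<open>I = J\<close>
  and \<open>\<alpha> = \<beta>\<close> and leaves \<open>\<alpha> m\<close>. Matches at other
  \<open>l\<close> contradict the index conditions.\<close>

lemma dual_form_top:
  fixes I J :: "'k::{finite,linorder} list" and \<alpha> \<beta> :: "'k \<Rightarrow> nat"
  assumes I: "(I, \<alpha>) \<in> index_set r s" "sum \<alpha> UNIV = r" and J: "(J, \<beta>) \<in> index_set r s"
    and r: "r \<ge> 1" and m: "m = Max {l. \<alpha> l > 0}"
  shows "taylor_coeff (\<alpha>(m := \<alpha> m - 1)) (jacobian (m # I) (monomial \<beta> # map coord J)) =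
    (if (I, \<alpha>) = (J, \<beta>) then real (\<alpha> m) else 0)"
proof -
  let ?K = "m # I" and ?\<gamma> = "\<alpha>(m := \<alpha> m - 1)"
  let ?P = "{\<sigma>. \<sigma> permutes {..<Suc s}}"
  \<comment> \<open>The product of the derivatives of the coordinates \<open>J\<close>, which sit in
    slots 1 to \<open>s\<close>. Slot 0 holds the monomial, differentiated in direction
    \<open>?K ! \<sigma> 0\<close>.\<close>
  let ?d = "\<lambda>\<sigma>. if \<forall>p<s. ?K ! \<sigma> (Suc p) = J ! p then 1 else (0::real)"
  have len: "length I = s" "length J = s" and sorted: "sorted_wrt (<) I" "sorted_wrt (<) J"
    using I(1) J by (auto simp: index_set_def)
  have last_I: "last I < m" using I by (simp add: index_set_def m)
  have \<alpha>m: "\<alpha> m > 0" using Max_support[of \<alpha>] I(2) r by (simp add: m)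
  have less_m: "i < m" if "i \<in> set I" for i
    using sorted_le_last[OF sorted(1) that] last_I by simp
  have distinct: "distinct ?K" using less_m sorted by (auto simp: strict_sorted_iff)
  have key: "real (\<beta> l) * (if \<beta>(l := \<beta> l - 1) = ?\<gamma> then 1 else 0) * ?d \<sigma> =
      (if \<sigma> = id then if (I, \<alpha>) = (J, \<beta>) then real (\<alpha> m) else 0 else 0)"
    if \<sigma>: "\<sigma> permutes {..<Suc s}" and l: "l = ?K ! \<sigma> 0" for \<sigma> l
  proof (cases "\<sigma> = id \<and> I = J \<and> \<alpha> = \<beta>")
    case True
    then show ?thesis using l by simp
  next
    case False
    have "\<not> (\<beta> l > 0 \<and> \<beta>(l := \<beta> l - 1) = ?\<gamma> \<and> (\<forall>p<s. ?K ! \<sigma> (Suc p) = J ! p))"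
    proof
      assume "\<beta> l > 0 \<and> \<beta>(l := \<beta> l - 1) = ?\<gamma> \<and> (\<forall>p<s. ?K ! \<sigma> (Suc p) = J ! p)"
      then have \<beta>l: "\<beta> l > 0" and \<gamma>: "\<beta>(l := \<beta> l - 1) = ?\<gamma>"
        and eq: "\<And>p. p < s \<Longrightarrow> ?K ! \<sigma> (Suc p) = J ! p" by auto
      have \<sigma>': "\<sigma> permutes {..<length ?K}" using \<sigma> len by simp
      have perm: "permute_list \<sigma> ?K = l # J"
      proof (intro nth_equalityI)
        fix p assume "p < length (permute_list \<sigma> ?K)"
        then show "permute_list \<sigma> ?K ! p = (l # J) ! p"
          using eq len l by (cases p) (simp_all add: permute_list_nth[OF \<sigma>'])
      qed (use len in simp)
      have msets: "mset (l # J) = mset ?K"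
        using mset_permute_list[OF \<sigma>'] perm by simp
      show False
      proof (cases "l = m")
        case True
        with msets have "I = J"
          by (intro strict_sorted_equal[OF sorted(2,1)]) (metis add_mset_add_mset_same_iff mset.simps(2) mset_eq_setD)
        moreover have "\<alpha> = \<beta>"
        proof
          fix i show "\<alpha> i = \<beta> i"
            using fun_cong[OF \<gamma>, of i] \<beta>l \<alpha>m True by (auto split: if_splits)
        qed
        moreover have "\<sigma> = id"
          using perm True \<open>I = J\<close> permute_list_eq_self_iff[OF \<sigma>' distinct] by simp
        ultimately show False using False by simp
      next
        \<comment> \<open>Now \<open>l\<close> lies in \<open>I\<close>, so \<open>l < m\<close>,
          and \<open>m\<close> lies in \<open>J\<close>. The largest variable of
          \<open>\<beta>\<close> then exceeds \<open>m\<close> and is untouched by lowering at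
          \<open>l\<close> or \<open>m\<close>, so it would also occur in \<open>\<alpha>\<close>,
          beyond the largest variable of \<open>\<alpha>\<close>.\<close>
        case neq: False
        have "l \<in> set I" "m \<in> set J"
          using mset_eq_setD[OF msets] neq by (auto simp: set_eq_iff)
        have "sum \<beta> UNIV = r"
          using sum_decr[of \<beta> l, OF \<beta>l] sum_decr[of \<alpha> m, OF \<alpha>m] I(2) unfolding \<gamma> by simp
        with J have "last J < Max {i. \<beta> i > 0}" by (simp add: index_set_def)
        then have less: "m < Max {i. \<beta> i > 0}"
          using sorted_le_last[OF sorted(2) \<open>m \<in> set J\<close>] by simp
        have "\<beta> (Max {i. \<beta> i > 0}) > 0"
          using Max_support[of \<beta>] \<open>sum \<beta> UNIV = r\<close> r by simp
        moreover have "Max {i. \<beta> i > 0} \<noteq> l" "Max {i. \<beta> i > 0} \<noteq> m"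
          using less less_m[OF \<open>l \<in> set I\<close>] by auto
        ultimately have "\<alpha> (Max {i. \<beta> i > 0}) > 0"
          using fun_cong[OF \<gamma>, of "Max {i. \<beta> i > 0}"] by simp
        from le_Max_support[of \<alpha>, OF this] less show False by (simp add: m)
      qed
    qed
    then have "real (\<beta> l) * (if \<beta>(l := \<beta> l - 1) = ?\<gamma> then 1 else 0) * ?d \<sigma> = 0"
      by auto
    with False show ?thesis by auto
  qed
  have jac: "jacobian ?K (monomial \<beta> # map coord J) = (\<lambda>u. \<Sum>\<sigma>\<in>?P. of_int (sign \<sigma>) * ?d \<sigma> *
      (real (\<beta> (?K ! \<sigma> 0)) * monomial (\<beta>(?K ! \<sigma> 0 := \<beta> (?K ! \<sigma> 0) - 1)) u))"
  proof
    fix u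
    have "(\<Prod>p<s. partial_deriv (?K ! \<sigma> (Suc p)) (map coord J ! p) u) = ?d \<sigma>" for \<sigma>
    proof -
      have "(\<Prod>p<s. partial_deriv (?K ! \<sigma> (Suc p)) (map coord J ! p) u) =
          (\<Prod>p<s. if ?K ! \<sigma> (Suc p) = J ! p then 1 else 0)"
        using len by (intro prod.cong) (auto simp: coord_def[abs_def] partial_deriv_coord)
      then show ?thesis by (simp add: prod_indicator)
    qed
    then show "jacobian ?K (monomial \<beta> # map coord J) u = (\<Sum>\<sigma>\<in>?P. of_int (sign \<sigma>) * ?d \<sigma> *
        (real (\<beta> (?K ! \<sigma> 0)) * monomial (\<beta>(?K ! \<sigma> 0 := \<beta> (?K ! \<sigma> 0) - 1)) u))"
      unfolding jacobian_def using len
      by (intro sum.cong) (simp_all add: prod.lessThan_Suc_shift partial_deriv_monomial mult_ac del: prod.lessThan_Suc)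
  qed
  have "taylor_coeff ?\<gamma> (jacobian ?K (monomial \<beta> # map coord J)) =
      (\<Sum>\<sigma>\<in>?P. of_int (sign \<sigma>) * ?d \<sigma> * (real (\<beta> (?K ! \<sigma> 0)) *
        (if \<beta>(?K ! \<sigma> 0 := \<beta> (?K ! \<sigma> 0) - 1) = ?\<gamma> then 1 else 0)))"
    unfolding jac
    by (subst taylor_coeff_sum)
      (simp_all add: taylor_coeff_cmult taylor_coeff_monomial smooth_cmult smooth_monomial)
  also have "\<dots> = (\<Sum>\<sigma>\<in>?P. if \<sigma> = id then if (I, \<alpha>) = (J, \<beta>) then real (\<alpha> m) else 0 else 0)"
  proof (intro sum.cong refl)
    fix \<sigma> assume "\<sigma> \<in> ?P"
    then have \<sigma>: "\<sigma> permutes {..<Suc s}" by simp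
    have "of_int (sign \<sigma>) * ?d \<sigma> * (real (\<beta> (?K ! \<sigma> 0)) *
        (if \<beta>(?K ! \<sigma> 0 := \<beta> (?K ! \<sigma> 0) - 1) = ?\<gamma> then 1 else 0)) =
        of_int (sign \<sigma>) * (if \<sigma> = id then if (I, \<alpha>) = (J, \<beta>) then real (\<alpha> m) else 0 else 0)"
      unfolding key[OF \<sigma> refl, symmetric] by (simp only: mult_ac)
    then show "of_int (sign \<sigma>) * ?d \<sigma> * (real (\<beta> (?K ! \<sigma> 0)) *
        (if \<beta>(?K ! \<sigma> 0 := \<beta> (?K ! \<sigma> 0) - 1) = ?\<gamma> then 1 else 0)) =
        (if \<sigma> = id then if (I, \<alpha>) = (J, \<beta>) then real (\<alpha> m) else 0 else 0)"
      by (cases "\<sigma> = id") (simp_all del: One_nat_def)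
  qed
  also have "\<dots> = (if (I, \<alpha>) = (J, \<beta>) then real (\<alpha> m) else 0)"
    by (subst sum.delta) (auto simp: finite_permutations permutes_id)
  finally show ?thesis .
qed

text \<open>Exact biorthogonality on the index set, not mere triangularity, so a preimage can be
  written down without inverting a matrix.\<close>

lemma dual_form_coords:
  assumes z: "z \<in> index_set r s" and J: "(J, \<beta>) \<in> index_set r s" and r: "r \<ge> 1"
  shows "dual_form r z (map coord J) (monomial \<beta>) = (if z = (J, \<beta>) then 1 else 0)"
proof -
  obtain I \<alpha> where I: "z = (I, \<alpha>)" by (cases z)
  show ?thesis
  proof (cases "sum \<alpha> UNIV < r")
    case True
    have "jacobian I (map coord J) u = (if I = J then 1 else 0)" for u
      using z J by (intro jacobian_coords) (auto simp: I index_set_def)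
    \<comment> \<open>The instance with constant 0 evaluates the zero function, which is what
      remains for \<open>I \<noteq> J\<close>.\<close>
    with True show ?thesis
      using taylor_coeff_monomial[of \<alpha> \<beta>] taylor_coeff_cmult[OF smooth_monomial, of \<alpha> 0 \<beta>]
      by (auto simp: I dual_form_def)
  next
    case False
    with z have sum: "sum \<alpha> UNIV = r" by (simp add: I index_set_def)
    let ?m = "Max {l. \<alpha> l > 0}"
    have "dual_form r z (map coord J) (monomial \<beta>) =
        1 / real (\<alpha> ?m) * (if (I, \<alpha>) = (J, \<beta>) then real (\<alpha> ?m) else 0)"
      by (simp only: I dual_form_def prod.case Let_def False if_False
          dual_form_top[OF z[unfolded I] sum J r refl])
    moreover have "\<alpha> ?m > 0"
      using Max_support[of \<alpha>] sum r by simp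
    ultimately show ?thesis
      by (auto simp: I)
  qed
qed

lemma finite_index_set: "finite (index_set r s)"
proof (rule finite_subset)
  show "index_set r s \<subseteq> {I. set I \<subseteq> UNIV \<and> length I = s} \<times> {\<alpha>. sum \<alpha> UNIV \<le> r}"
    by (auto simp: index_set_def)
qed (intro finite_cartesian_product finite_lists_length_eq finite_multi_indices finite_class.finite_UNIV)

lemma coord_map_eq:
  "(I, \<alpha>) \<in> index_set r s \<Longrightarrow> coord_map r s F (I, \<alpha>) = F (map (jet r) (map coord I)) (jet r (monomial \<alpha>))"
  by (simp add: coord_map_def jet_monom_eq jet_coord_def[abs_def] coord_def[abs_def] comp_def)

text \<open>On the carriers every argument is the jet of its representative; elsewhere the extension
  by 0 decides. Together this gives equality of functions on all arguments.\<close>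

lemma form_eq_0:
  fixes F :: "(real^'k::{finite,linorder} \<Rightarrow> real) set list \<Rightarrow> (real^'k::{finite,linorder} \<Rightarrow> real) set \<Rightarrow> real"
  assumes F: "F \<in> carrier (forms (jet_algebra r) s)" and rs: "r \<ge> 1" "s \<ge> 1"
    and zero: "\<And>z. z \<in> index_set r s \<Longrightarrow> coord_map r s F z = 0"
  shows "F v d = 0"
proof -
  let ?A = "jet_algebra r :: (real, (real^'k::{finite,linorder} \<Rightarrow> real) set) module"
  have F': "F \<in> multilinear_maps ?A s" using F by (simp add: forms_def)
  show ?thesis
  proof (cases "v \<in> tuples ?A s \<and> d \<in> carrier ?A")
    case True
    then have v: "v = map (jet r) (map (jet_rep r) v)" "length (map (jet_rep r) v) = s"
        "set (map (jet_rep r) v) \<subseteq> Collect smooth"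
      by (auto simp: tuples_def jet_rep subset_iff map_idI)
    have d: "d = jet r (jet_rep r d)" "smooth (jet_rep r d)"
      using True by (simp_all add: jet_rep)
    have "F (map (jet r) (map (jet_rep r) v)) (jet r (jet_rep r d)) = 0"
      using zero
      by (intro smooth_form_eq_0[OF smooth_form_of_form[OF F] rs _ v(2,3) d(2)]) (metis coord_map_eq)
    with v(1) d(1) show ?thesis by metis
  next
    case False
    with F' show ?thesis by (auto simp: multilinear_maps_def dual_def)
  qed
qed

theorem mainTheorem1:
  fixes r s :: nat
  assumes "r \<ge> 1" and "s \<ge> 1"
  shows "coord_map r s \<in> vector_space_iso
           (forms (jet_algebra r :: (real, (real^'k::{finite,linorder} \<Rightarrow> real) set) module) s)
           (function_space (index_set r s))"
proof -
  let ?V = "forms (jet_algebra r :: (real, (real^'k::{finite,linorder} \<Rightarrow> real) set) module) s"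
  let ?Z = "index_set r s :: ('k::{finite,linorder} list \<times> ('k::{finite,linorder} \<Rightarrow> nat)) set"
  interpret V: Module.module real_field ?V by (rule module_forms)
  have linear: "coord_map r s (\<lambda>v d. F v d + c * G v d) =
      (\<lambda>z. coord_map r s F z + c * coord_map r s G z)"
    for c and F G :: "(real^'k::{finite,linorder} \<Rightarrow> real) set list \<Rightarrow> (real^'k::{finite,linorder} \<Rightarrow> real) set \<Rightarrow> real"
    by (auto simp: coord_map_def)
  have "inj_on (coord_map r s) (carrier ?V)"
  proof (rule inj_onI)
    fix F G assume F: "F \<in> carrier ?V" and G: "G \<in> carrier ?V"
      and eq: "coord_map r s F = coord_map r s G"
    have "F \<oplus>\<^bsub>?V\<^esub> ((-1) \<odot>\<^bsub>?V\<^esub> G) \<in> carrier ?V"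
      using F G V.smult_closed[of "-1" G] by (intro V.add.m_closed) simp_all
    then have "(\<lambda>v d. F v d + (-1) * G v d) \<in> carrier ?V"
      by (simp add: forms_def)
    moreover have "coord_map r s (\<lambda>v d. F v d + (-1) * G v d) z = 0" for z
      using linear[of F "-1" G] eq by simp
    ultimately have "F v d + (-1) * G v d = 0" for v d
      using form_eq_0[OF _ assms] by blast
    then show "F = G" by (simp add: fun_eq_iff)
  qed
  moreover have "coord_map r s ` carrier ?V = carrier (function_space ?Z)"
  proof (intro equalityI subsetI)
    fix \<phi> assume "\<phi> \<in> coord_map r s ` carrier ?V"
    then show "\<phi> \<in> carrier (function_space ?Z)"
      by (auto simp: function_space_def coord_map_def)
  next
    fix \<phi> assume \<phi>: "\<phi> \<in> carrier (function_space ?Z)"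
    \<comment> \<open>The combination of the dual basis with coefficients \<open>\<phi>\<close>;
      biorthogonality makes its coordinate at \<open>z\<close> equal to
      \<open>\<phi> z\<close>.\<close>
    define G where "G = (\<lambda>fs f. \<Sum>z\<in>?Z. \<phi> z * dual_form r z fs f)"
    interpret G: smooth_form r s G
      unfolding G_def using assms by (intro smooth_form_sum smooth_form_cmult smooth_form_dual_form)
    have "coord_map r s (lift_form r s G) z = \<phi> z" for z
    proof (cases "z \<in> ?Z")
      case True
      obtain I \<alpha> where z: "z = (I, \<alpha>)" by (cases z)
      from True have "length I = s" by (simp add: z index_set_def)
      then have "coord_map r s (lift_form r s G) z = G (map coord I) (monomial \<alpha>)"
        using True unfolding z
        by (subst coord_map_eq, simp, subst G.lift_form_jet) (auto simp: smooth_coord_fun smooth_monomial)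
      also have "\<dots> = (\<Sum>z'\<in>?Z. if z' = z then \<phi> z else 0)"
        using True assms unfolding G_def by (intro sum.cong) (auto simp: z dual_form_coords)
      also have "\<dots> = \<phi> z"
        using True by (simp add: finite_index_set)
      finally show ?thesis .
    next
      case False
      with \<phi> show ?thesis
        by (cases z) (simp add: coord_map_def function_space_def)
    qed
    then show "\<phi> \<in> coord_map r s ` carrier ?V"
      using G.lift_form_in_forms by (intro image_eqI[of _ _ "lift_form r s G"]) auto
  qed
  ultimately have "bij_betw (coord_map r s) (carrier ?V) (carrier (function_space ?Z))"
    by (simp add: bij_betw_def)
  moreover have "coord_map r s F \<in> carrier (function_space ?Z)"
    and "coord_map r s (F \<oplus>\<^bsub>?V\<^esub> G) = coord_map r s F \<oplus>\<^bsub>function_space ?Z\<^esub> coord_map r s G"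
    and "coord_map r s (c \<odot>\<^bsub>?V\<^esub> F) = c \<odot>\<^bsub>function_space ?Z\<^esub> coord_map r s F" for F G c
    by (auto simp: forms_def function_space_def coord_map_def)
  ultimately show ?thesis
    by (simp add: vector_space_iso_def iso_def hom_def)
qed

end
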